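(* Consider the regression model $y=X\beta+\epsilon$ with $\epsilon\sim\mathcal E_n(0,\sigma^2V,g)$, and the quadratic risk $R(\beta^*;\beta)=E[(\beta^*-\beta)'\mathbf W(\beta^*-\beta)]$ for a given positive definite $p\times p$ matrix $\mathbf W$. Let $q\ge3$, $m=n-p$, $d=\frac{(q-2)m}{q(m+2)}$, and let $$\hat\beta^S=\tilde\beta-d\,\mathcal L_n^{-1}(\tilde\beta-\hat\beta),\qquad \hat\beta^{S+}=\hat\beta+(1-d\,\mathcal L_n^{-1})\,I(\mathcal L_n>d)\,(\tilde\beta-\hat\beta).$$ Then under $H_0:H\beta=h$, $$R(\hat\beta^S;\beta)=R(\hat\beta;\beta)+\sigma_\epsilon^2(1-d)\,\mathrm{tr}(A_{11})\ \ge\ R(\hat\beta;\beta)\qquad\text{and}\qquad R(\hat\beta^{S+};\beta)\ge R(\hat\beta;\beta).$$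
   Context: Model: $y=X\beta+\epsilon$, where $X$ is a fixed $n\times p$ matrix of full column rank $p<n$, $V$ is a known positive definite $n\times n$ matrix, $\beta\in\mathbb R^p$ and $\sigma>0$ are unknown, and $\epsilon\sim\mathcal E_n(0,\sigma^2V,g)$ has density $|\sigma^2V|^{-1/2}g(\epsilon'V^{-1}\epsilon/\sigma^2)$ of the form $$f_\epsilon(x)=\int_0^\infty \phi_{N_n(0,t^{-1}\sigma^2V)}(x)\,\mathcal W(dt),$$ where $\phi_{N_n(0,\Sigma)}$ is the density of $N_n(0,\Sigma)$ and $\mathcal W$ is a (possibly signed) measure on $(0,\infty)$, not depending on $\beta,\sigma$, with $\int_0^\infty\mathcal W(dt)=1$ and with Jordan decomposition $\mathcal W=\mathcal W^+-\mathcal W^-$ satisfying $\int t^{-1}\mathcal W^\pm(dt)<\infty$. Put $\sigma_\epsilon^2=\sigma^2\int_0^\infty t^{-1}\mathcal W(dt)$, so that $\mathrm{Cov}(\epsilon)=\sigma_\epsilon^2V$. Estimators: $C=X'V^{-1}X$; $\tilde\beta=C^{-1}X'V^{-1}y$; $S^2=(y-X\tilde\beta)'V^{-1}(y-X\tilde\beta)/(n-p)$; $H$ is a known $q\times p$ matrix of full row rank $q<p$, $h\in\mathbb R^q$ is known, $V_1=(HC^{-1}H')^{-1}$; $\hat\beta=\tilde\beta-C^{-1}H'V_1(H\tilde\beta-h)$ (restricted estimator); $\mathcal L_n=(H\tilde\beta-h)'V_1(H\tilde\beta-h)/(qS^2)$. $I(\cdot)$ is the indicator function. The matrix $C^{-1/2}H'V_1HC^{-1/2}$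 is a symmetric idempotent of rank $q$; $Q$ is an orthogonal matrix with $Q\,C^{-1/2}H'V_1HC^{-1/2}Q'=\begin{pmatrix}I_q&0\\0&0\end{pmatrix}$, and $A_{11}$ is the upper-left $q\times q$ block of $A=QC^{-1/2}\mathbf WC^{-1/2}Q'$. *)

theory Defs
  imports "HOL-Probability.Probability"
begin

section \<open>Matrices\<close>

definition pos_def :: "real^'n^'n \<Rightarrow> bool" where
  "pos_def A \<longleftrightarrow> transpose A = A \<and> (\<forall>x. x \<noteq> 0 \<longrightarrow> 0 < x \<bullet> (A *v x))"

text \<open>The square root and the inverse square root are meaningful for positive definite
  arguments only, where exactly one matrix satisfies the description.\<close>

definition matrix_sqrt :: "real^'n^'n \<Rightarrow> real^'n^'n" where
  "matrix_sqrt A = (THE B. pos_def B \<and> B ** B = A)"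

definition matrix_inv_sqrt :: "real^'n^'n \<Rightarrow> real^'n^'n" where
  "matrix_inv_sqrt A = matrix_inv (matrix_sqrt A)"

text \<open>An injection \<open>ix :: 'q \<Rightarrow> 'p\<close> names the index positions that play the role of the
  first \<open>q\<close> of the \<open>p\<close> coordinates, since a finite index type carries no canonical order.\<close>

definition block_identity :: "('q::finite \<Rightarrow> 'p::finite) \<Rightarrow> real^'p^'p" where
  "block_identity ix = (\<chi> i j. if i = j \<and> i \<in> range ix then 1 else 0)"

definition leading_block :: "('q::finite \<Rightarrow> 'p::finite) \<Rightarrow> real^'p^'p \<Rightarrow> real^'q^'q" where
  "leading_block ix A = (\<chi> i j. A $ ix i $ ix j)"

section \<open>Elliptical errors\<close>

definition normal_vec_density :: "real^'n \<Rightarrow> real^'n^'n \<Rightarrow> real^'n \<Rightarrow> real" where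
  "normal_vec_density \<mu> \<Sigma> x =
     (2 * pi) powr (- real CARD('n) / 2) * det \<Sigma> powr (- 1 / 2) *
     exp (- ((x - \<mu>) \<bullet> (matrix_inv \<Sigma> *v (x - \<mu>))) / 2)"

definition elliptical ::
  "'w measure \<Rightarrow> ('w \<Rightarrow> real^'n) \<Rightarrow> real^'n \<Rightarrow> real^'n^'n \<Rightarrow> (real \<Rightarrow> real) \<Rightarrow> bool" where
  "elliptical M Z \<mu> \<Sigma> g \<longleftrightarrow>
     (\<forall>u\<ge>0. 0 \<le> g u) \<and>
     distributed M lborel Z
       (\<lambda>x. ennreal (det \<Sigma> powr (- 1 / 2) * g ((x - \<mu>) \<bullet> (matrix_inv \<Sigma> *v (x - \<mu>)))))"

text \<open>A signed measure on \<open>(0, \<infinity>)\<close> is represented by its Jordan decomposition, that is, by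
  two mutually singular measures \<open>Wp\<close> and \<open>Wm\<close>. Both parts are finite, because the signed
  measure is required to have total mass 1.\<close>

definition jordan_pair :: "real measure \<Rightarrow> real measure \<Rightarrow> bool" where
  "jordan_pair Wp Wm \<longleftrightarrow>
     sets Wp = sets (restrict_space borel {0<..}) \<and>
     sets Wm = sets (restrict_space borel {0<..}) \<and>
     finite_measure Wp \<and> finite_measure Wm \<and>
     (\<exists>P\<in>sets (restrict_space borel {0<..}).
        emeasure Wm P = 0 \<and> emeasure Wp ({0<..} - P) = 0)"

definition signed_integral :: "real measure \<Rightarrow> real measure \<Rightarrow> (real \<Rightarrow> real) \<Rightarrow> real" where
  "signed_integral Wp Wm f = (\<integral>t. f t \<partial>Wp) - (\<integral>t. f t \<partial>Wm)"

definition mixing_measure :: "real measure \<Rightarrow> real measure \<Rightarrow> bool" where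
  "mixing_measure Wp Wm \<longleftrightarrow>
     jordan_pair Wp Wm \<and>
     signed_integral Wp Wm (\<lambda>t. 1) = 1 \<and>
     integrable Wp (\<lambda>t. 1 / t) \<and> integrable Wm (\<lambda>t. 1 / t)"

text \<open>The two expressions for the density are identified almost everywhere: the mixture integral
  may diverge at the origin.\<close>

definition normal_mixture ::
  "real measure \<Rightarrow> real measure \<Rightarrow> real^'n^'n \<Rightarrow> (real \<Rightarrow> real) \<Rightarrow> bool" where
  "normal_mixture Wp Wm \<Sigma> g \<longleftrightarrow>
     (AE x in lborel. det \<Sigma> powr (- 1 / 2) * g (x \<bullet> (matrix_inv \<Sigma> *v x)) =
        signed_integral Wp Wm (\<lambda>t. normal_vec_density 0 ((1 / t) *\<^sub>R \<Sigma>) x))"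

section \<open>Estimators in the linear model\<close>

definition gram :: "real^'p^'n \<Rightarrow> real^'n^'n \<Rightarrow> real^'p^'p" where
  "gram X V = transpose X ** matrix_inv V ** X"

definition gls :: "real^'p^'n \<Rightarrow> real^'n^'n \<Rightarrow> real^'n \<Rightarrow> real^'p" where
  "gls X V y = (matrix_inv (gram X V) ** transpose X ** matrix_inv V) *v y"

definition scale_est :: "real^'p^'n \<Rightarrow> real^'n^'n \<Rightarrow> real^'n \<Rightarrow> real" where
  "scale_est X V y =
     (y - X *v gls X V y) \<bullet> (matrix_inv V *v (y - X *v gls X V y)) /
     (real CARD('n) - real CARD('p))"

definition V1 :: "real^'p^'n \<Rightarrow> real^'n^'n \<Rightarrow> real^'p^'q \<Rightarrow> real^'q^'q" where
  "V1 X V H = matrix_inv (H ** matrix_inv (gram X V) ** transpose H)"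

definition restricted_est ::
  "real^'p^'n \<Rightarrow> real^'n^'n \<Rightarrow> real^'p^'q \<Rightarrow> real^'q \<Rightarrow> real^'n \<Rightarrow> real^'p" where
  "restricted_est X V H h y =
     gls X V y - (matrix_inv (gram X V) ** transpose H ** V1 X V H) *v (H *v gls X V y - h)"

definition test_stat ::
  "real^'p^'n \<Rightarrow> real^'n^'n \<Rightarrow> real^'p^'q \<Rightarrow> real^'q \<Rightarrow> real^'n \<Rightarrow> real" where
  "test_stat X V H h y =
     (H *v gls X V y - h) \<bullet> (V1 X V H *v (H *v gls X V y - h)) /
     (real CARD('q) * scale_est X V y)"

definition stein_est ::
  "real \<Rightarrow> real^'p^'n \<Rightarrow> real^'n^'n \<Rightarrow> real^'p^'q \<Rightarrow> real^'q \<Rightarrow> real^'n \<Rightarrow> real^'p" where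
  "stein_est d X V H h y =
     gls X V y - (d * inverse (test_stat X V H h y)) *\<^sub>R (gls X V y - restricted_est X V H h y)"

definition pos_stein_est ::
  "real \<Rightarrow> real^'p^'n \<Rightarrow> real^'n^'n \<Rightarrow> real^'p^'q \<Rightarrow> real^'q \<Rightarrow> real^'n \<Rightarrow> real^'p" where
  "pos_stein_est d X V H h y =
     restricted_est X V H h y +
     ((1 - d * inverse (test_stat X V H h y)) * indicator {d<..} (test_stat X V H h y)) *\<^sub>R
       (gls X V y - restricted_est X V H h y)"

section \<open>Quadratic risk\<close>

definition quad_loss :: "real^'p^'p \<Rightarrow> real^'p \<Rightarrow> real^'p \<Rightarrow> real" where
  "quad_loss W b \<beta> = (b - \<beta>) \<bullet> (W *v (b - \<beta>))"

definition risk :: "'w measure \<Rightarrow> real^'p^'p \<Rightarrow> ('w \<Rightarrow> real^'p) \<Rightarrow> real^'p \<Rightarrow> real" where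
  "risk M W b \<beta> = (\<integral>\<omega>. quad_loss W (b \<omega>) \<beta> \<partial>M)"

text \<open>The Bochner integral of a non-integrable function is 0, so assertions about \<^const>\<open>risk\<close>
  are accompanied by the finiteness of the expectation.\<close>

definition finite_risk :: "'w measure \<Rightarrow> real^'p^'p \<Rightarrow> ('w \<Rightarrow> real^'p) \<Rightarrow> real^'p \<Rightarrow> bool" where
  "finite_risk M W b \<beta> \<longleftrightarrow> integrable M (\<lambda>\<omega>. quad_loss W (b \<omega>) \<beta>)"

end

theory Submission
  imports Defs
begin

text \<open>Whitening the errors with \<open>V\<^sup>-\<^sup>1\<^sup>/\<^sup>2\<close> turns the estimation error under the restriction
  into \<open>K z + a(z) B z\<close>, where \<open>B\<close> factors through a projection \<open>P\<close> of rank \<open>q\<close>, \<open>K\<close> vanishes on its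
  range, and the factor \<open>a\<close> depends on \<open>z\<close> only through \<open>|P z|\<^sup>2\<close> and the residual sum of squares
  \<open>|R z|\<^sup>2\<close> (\<open>a = 0\<close> for the restricted estimator, \<open>a = 1 - c |R z|\<^sup>2 / |P z|\<^sup>2\<close> with
  \<open>c = (q - 2) / (m + 2)\<close> for the Stein estimator). All losses are homogeneous of degree 2, so the
  mixture representation reduces every risk to \<open>\<sigma>\<^sub>\<epsilon>\<^sup>2\<close> times its standard Gaussian counterpart. There
  the reflection through the kernel of \<open>P\<close> removes the cross term, and what remains is governed by
  \<open>E|P z|\<^sup>2 = q\<close>, \<open>E|R z|\<^sup>2 = m\<close> and \<open>E(|R z|\<^sup>4 / |P z|\<^sup>2) = m (m + 2) / (q - 2)\<close>.\<close>

section \<open>Square roots of positive definite matrices\<close>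

text \<open>Under \<open>H0\<close> the constant \<open>H \<beta> - h\<close> cancels, so every
  estimation error is positively homogeneous in the noise; this is the source of the degree 2. The
  mixing measure may be signed, so \<open>t\<close> cannot be treated as a random scale to condition
  on. Fubini is applied to \<open>Wp\<close> and \<open>Wm\<close> separately, each time with
  absolute integrability, and the results are subtracted. For the same reason the sign of
  \<open>sigma_eps_sq\<close> is not visible from its formula; it is read off from a second moment
  of the errors themselves. The constant \<open>c = d q / m\<close> is the one for which
  \<open>d\<close> times the inverse statistic equals \<open>c |R z|^2 / |P z|^2\<close>. It also
  minimises the quadratic \<open>q - 2 c m + c^2 m (m + 2) / (q - 2)\<close>, whose minimum is
  \<open>q - c m = (1 - d) q\<close>; hence the factor \<open>1 - d\<close> in the excess risk. Both
  inequalities hold because the risk splits into the restricted risk plus an integral of a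
  nonnegative function. The Stein estimator enters the treatment of its positive part only as an
  integrable bound.\<close>

lemma inner_matrix_vector_transpose: "(A *v x) \<bullet> y = x \<bullet> (transpose A *v y)"
  for A :: "real^'n^'m"
  by (metis dot_lmul_matrix inner_commute vector_transpose_matrix)

lemma symmetric_inner_swap:
  fixes A :: "real^'n^'n"
  assumes "transpose A = A"
  shows "x \<bullet> (A *v y) = (A *v x) \<bullet> y"
  using inner_matrix_vector_transpose[of A x y] by (simp only: assms)

text \<open>A maximiser \<open>v\<close> of the quadratic form on the unit sphere of
  \<open>S\<close> is an eigenvector: the residual \<open>w = A v - l v\<close> stays in
  \<open>S\<close> by invariance, and moving from \<open>v\<close> towards \<open>w\<close> would
  raise the form to first order unless \<open>w = 0\<close>. Staying inside \<open>S\<close>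
  prepares the induction that builds a basis.\<close>

lemma invariant_subspace_eigenvector:
  fixes A :: "real^'n^'n" and S :: "(real^'n) set"
  assumes sym: "transpose A = A" and S: "subspace S" "\<And>x. x \<in> S \<Longrightarrow> A *v x \<in> S"
    and ne: "dim S \<noteq> 0"
  obtains v l where "v \<in> S" "norm v = 1" "A *v v = l *\<^sub>R v"
proof -
  obtain u where u: "u \<in> S" "u \<noteq> 0"
    using ne by (metis dim_eq_0 singletonI subsetI)
  have "compact (S \<inter> sphere 0 1)"
    using closed_subspace[OF S(1)] by (simp add: closed_Int_compact)
  moreover have "(1 / norm u) *\<^sub>R u \<in> S \<inter> sphere 0 1"
    using u S(1) by (auto intro: subspace_scale)
  moreover have "continuous_on (S \<inter> sphere 0 1) (\<lambda>x. x \<bullet> (A *v x))"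
    by (intro continuous_intros matrix_vector_mult_linear_continuous_on)
  ultimately have "\<exists>v\<in>S \<inter> sphere 0 1. \<forall>x\<in>S \<inter> sphere 0 1. x \<bullet> (A *v x) \<le> v \<bullet> (A *v v)"
    by (intro continuous_attains_sup) auto
  then obtain v where v: "v \<in> S" "norm v = 1"
    and max: "\<And>x. x \<in> S \<Longrightarrow> norm x = 1 \<Longrightarrow> x \<bullet> (A *v x) \<le> v \<bullet> (A *v v)"
    by auto
  define l where "l = v \<bullet> (A *v v)"
  have le: "x \<bullet> (A *v x) \<le> l * (x \<bullet> x)" if "x \<in> S" for x
  proof (cases "x = 0")
    case False
    have "(1 / norm x) *\<^sub>R x \<bullet> (A *v ((1 / norm x) *\<^sub>R x)) \<le> l"
      unfolding l_def by (rule max) (use that S(1) False in \<open>auto intro: subspace_scale\<close>)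
    then have "(x \<bullet> (A *v x)) / (norm x)\<^sup>2 \<le> l"
      by (simp add: matrix_vector_mult_scaleR power2_eq_square)
    then show ?thesis using False
      by (simp add: field_simps power2_norm_eq_inner)
  qed simp
  define w where "w = A *v v - l *\<^sub>R v"
  have wS: "w \<in> S" unfolding w_def using S v(1) by (simp add: subspace_diff subspace_scale)
  define a b where "a = w \<bullet> w" and "b = w \<bullet> (A *v w) - l * (w \<bullet> w)"
  have vv: "v \<bullet> v = 1" using v(2) by (simp add: norm_eq_1)
  \<comment> \<open>This is \<open>le\<close> at \<open>v + t w\<close>: the terms free of
    \<open>t\<close> cancel, and since \<open>w \<bullet> A v = a + l (v \<bullet> w)\<close> the
    linear terms leave just \<open>2 t a\<close>.\<close>
  have quad: "2 * t * a + t\<^sup>2 * b \<le> 0" for t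
  proof -
    have "(v + t *\<^sub>R w) \<bullet> (A *v (v + t *\<^sub>R w)) \<le> l * ((v + t *\<^sub>R w) \<bullet> (v + t *\<^sub>R w))"
      by (rule le) (use S(1) v(1) wS in \<open>auto intro: subspace_scale subspace_add\<close>)
    moreover have "v \<bullet> (A *v w) = w \<bullet> (A *v v)"
      using symmetric_inner_swap[OF sym, of v w] by (simp add: inner_commute)
    moreover have "w \<bullet> (A *v v) = a + l * (v \<bullet> w)"
      unfolding a_def by (subst (2) w_def) (simp add: inner_diff_right inner_commute)
    ultimately show ?thesis
      using vv l_def
      by (simp add: matrix_vector_right_distrib matrix_vector_mult_scaleR inner_add_left
          inner_add_right b_def a_def power2_eq_square inner_commute algebra_simps)
  qed
  have "a \<le> 0"
  proof (rule ccontr)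
    assume "\<not> a \<le> 0"
    then have a: "a > 0" by simp
    \<comment> \<open>Small enough for \<open>t |b| < a\<close>, so that the linear term beats the
      quadratic one.\<close>
    define t where "t = a / (1 + \<bar>b\<bar>)"
    have t: "t > 0" using a by (simp add: t_def add_pos_nonneg)
    have "t * \<bar>b\<bar> < a" using a by (simp add: t_def field_simps add_pos_nonneg)
    then have "- a < t * b" using t by (smt (verit) mult_minus_right mult_left_mono)
    then have "0 < t * (2 * a + t * b)" using t a by simp
    then show False using quad[of t] by (simp add: power2_eq_square algebra_simps)
  qed
  then have "w = 0" using inner_ge_zero[of w] by (simp add: a_def)
  then show ?thesis using that[of v l] v by (simp add: w_def)
qed

text \<open>By symmetry the orthogonal complement of an eigenvector within \<open>S\<close> is again
  invariant: \<open>v \<bullet> A x = A v \<bullet> x = l (v \<bullet> x)\<close>. Each unit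
  eigenvector split off lowers \<open>dim S\<close> by one.\<close>

lemma invariant_subspace_eigenbasis:
  fixes A :: "real^'n^'n" and S :: "(real^'n) set"
  assumes sym: "transpose A = A" and "subspace S" "\<And>x. x \<in> S \<Longrightarrow> A *v x \<in> S"
  shows "\<exists>B\<subseteq>S. finite B \<and> card B = dim S \<and> pairwise orthogonal B \<and>
    (\<forall>v\<in>B. norm v = 1 \<and> (\<exists>l. A *v v = l *\<^sub>R v))"
  using assms(2,3)
proof (induction "dim S" arbitrary: S)
  case 0
  then show ?case by (intro exI[of _ "{}"]) auto
next
  case (Suc k)
  have "dim S \<noteq> 0" using Suc.hyps(2) by linarith
  then obtain v l where v: "v \<in> S" "norm v = 1" "A *v v = l *\<^sub>R v"
    using invariant_subspace_eigenvector[OF sym Suc.prems] by blast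
  define S' where "S' = {y \<in> S. \<forall>x\<in>span {v}. orthogonal x y}"
  have S'_iff: "y \<in> S' \<longleftrightarrow> y \<in> S \<and> v \<bullet> y = 0" for y
    unfolding S'_def by (auto simp: span_singleton orthogonal_def)
  have "subspace S'"
    unfolding subspace_def using Suc.prems(1)
    by (auto simp: S'_iff inner_add_right intro: subspace_add subspace_scale subspace_0)
  moreover have "A *v x \<in> S'" if "x \<in> S'" for x
    using that Suc.prems(2) symmetric_inner_swap[OF sym, of v x] v by (simp add: S'_iff)
  moreover have "dim S' + dim (span {v}) = dim S"
    unfolding S'_def
    by (rule dim_subspace_orthogonal_to_vectors)
      (use Suc.prems(1) v(1) span_minimal[of "{v}" S] in auto)
  then have "k = dim S'" using Suc.hyps(2) v(2) by (cases "v = 0") auto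
  ultimately obtain B where B: "B \<subseteq> S'" "finite B" "card B = k" "pairwise orthogonal B"
    "\<forall>v\<in>B. norm v = 1 \<and> (\<exists>l. A *v v = l *\<^sub>R v)"
    using Suc.hyps(1)[of S'] by metis
  have "v \<notin> B" using B(1) v(2) by (auto simp: S'_iff)
  moreover have "pairwise orthogonal (insert v B)"
    using B(1,4) by (auto simp: pairwise_insert orthogonal_def S'_iff inner_commute)
  ultimately show ?case
    using B v Suc.hyps(2) S'_iff
    by (intro exI[of _ "insert v B"] conjI) (simp_all, blast+)
qed

theorem symmetric_matrix_eigenbasis:
  fixes A :: "real^'n^'n"
  assumes "transpose A = A"
  obtains U :: "real^'n^'n" and l where "orthogonal_matrix U" "\<And>i. A *v column i U = l i *\<^sub>R column i U"
proof -
  obtain B :: "(real^'n) set" where B: "finite B" "card B = CARD('n)" "pairwise orthogonal B"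
    "\<forall>v\<in>B. norm v = 1 \<and> (\<exists>l. A *v v = l *\<^sub>R v)"
    using invariant_subspace_eigenbasis[OF assms, of UNIV] by auto
  obtain f :: "'n \<Rightarrow> real^'n" where f: "bij_betw f UNIV B"
    using finite_same_card_bij[of "UNIV :: 'n set" B] B by auto
  define U :: "real^'n^'n" where "U = (\<chi> i j. f j $ i)"
  have col: "column j U = f j" for j by (simp add: U_def column_def vec_eq_iff)
  have fB: "f i \<in> B" for i using f by (auto simp: bij_betw_def)
  have "orthogonal_matrix U"
    unfolding orthogonal_matrix_orthonormal_columns col
  proof (intro conjI allI impI)
    show "norm (f i) = 1" for i using fB B(4) by blast
    show "orthogonal (f i) (f j)" if "i \<noteq> j" for i j
    proof -
      have "f i \<noteq> f j" using that f by (auto simp: bij_betw_def inj_on_def)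
      then show ?thesis using B(3) fB by (simp add: pairwise_def)
    qed
  qed
  moreover have "\<forall>i. \<exists>l. A *v f i = l *\<^sub>R f i" using fB B(4) by blast
  then obtain l where "\<And>i. A *v f i = l i *\<^sub>R f i" by metis
  ultimately show ?thesis using that[of U l] by (simp only: col)
qed

section \<open>Diagonalisation of symmetric matrices and the square root\<close>

definition diag_matrix :: "('n \<Rightarrow> real) \<Rightarrow> real^'n^'n" where
  "diag_matrix l = (\<chi> i j. if i = j then l i else 0)"

lemma diag_matrix_vector: "(diag_matrix l *v x) $ i = l i * x $ i"
  unfolding diag_matrix_def matrix_vector_mult_def
  by (simp add: if_distrib[of "\<lambda>c. c * _"] sum.delta cong: if_cong)

lemma diag_matrix_mult: "diag_matrix k ** diag_matrix l = diag_matrix (\<lambda>i. k i * l i)"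
  by (subst matrix_eq) (simp add: matrix_vector_mul_assoc[symmetric] vec_eq_iff diag_matrix_vector)

lemma transpose_diag_matrix: "transpose (diag_matrix l) = diag_matrix l"
  by (simp add: diag_matrix_def transpose_def vec_eq_iff)

lemma matrix_mult_eigencolumns:
  fixes A U :: "real^'n^'n"
  assumes e: "\<And>i. A *v column i U = l i *\<^sub>R column i U"
  shows "A ** U = U ** diag_matrix l"
proof -
  have "(A ** U) $ k $ i = (U ** diag_matrix l) $ k $ i" for i k
  proof -
    have "(A ** U) $ k $ i = (A *v column i U) $ k"
      by (simp add: matrix_matrix_mult_def matrix_vector_mult_def column_def)
    also have "\<dots> = l i * U $ k $ i" by (simp only: e) (simp add: column_def)
    also have "\<dots> = (U ** diag_matrix l) $ k $ i"
      by (simp add: column_def matrix_matrix_mult_def diag_matrix_def mult.commute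
          if_distrib[of "\<lambda>c. _ * c"] if_distrib[of "\<lambda>c. c * _"] sum.delta sum.delta' cong: if_cong)
    finally show ?thesis .
  qed
  then show ?thesis by (simp add: vec_eq_iff)
qed

lemma symmetric_matrix_diagonalization:
  fixes A :: "real^'n^'n"
  assumes "transpose A = A"
  obtains U l where "orthogonal_matrix U" "A = U ** diag_matrix l ** transpose U"
proof -
  obtain U l where U: "orthogonal_matrix U" and e: "\<And>i. A *v column i U = l i *\<^sub>R column i U"
    using symmetric_matrix_eigenbasis[OF assms] by blast
  have "A ** U = U ** diag_matrix l" by (rule matrix_mult_eigencolumns[OF e])
  then have "A = U ** diag_matrix l ** transpose U"
    using U matrix_mul_assoc[of A U "transpose U"] by (simp add: orthogonal_matrix_def)
  with U that show ?thesis by blast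
qed

lemma matrix_inv_mult:
  fixes A :: "real^'n^'n"
  assumes "invertible A"
  shows matrix_inv_right: "A ** matrix_inv A = mat 1" and matrix_inv_left: "matrix_inv A ** A = mat 1"
  using someI_ex[OF assms[unfolded invertible_def]] by (auto simp: matrix_inv_def)

lemma matrix_sub_ldistrib: "(A :: real^'n^'m) ** (B - C) = A ** B - A ** C"
  by (simp add: matrix_matrix_mult_def vec_eq_iff sum_subtractf algebra_simps)

lemma matrix_sub_rdistrib: "(B - C :: real^'n^'m) ** A = B ** A - C ** A"
  by (simp add: matrix_matrix_mult_def vec_eq_iff sum_subtractf algebra_simps)

lemma matrix_mul_uminus_right: "(A :: real^'n^'m) ** (- B) = - (A ** B)"
  by (simp add: matrix_matrix_mult_def vec_eq_iff sum_negf)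

lemma trace_uminus: "trace (- A :: real^'n^'n) = - trace A"
  by (simp add: trace_def sum_negf)

lemma pos_def_transpose: "pos_def A \<Longrightarrow> transpose A = A"
  by (simp add: pos_def_def)

text \<open>In an orthonormal eigenbasis it suffices to take roots of the eigenvalues, once these
  are known to be positive.\<close>

lemma pos_def_square_root_exists:
  fixes A :: "real^'n^'n"
  assumes "pos_def A"
  shows "\<exists>B. pos_def B \<and> B ** B = A"
proof -
  obtain U l where U: "orthogonal_matrix U" and A: "A = U ** diag_matrix l ** transpose U"
    using symmetric_matrix_diagonalization[OF pos_def_transpose[OF assms]] by blast
  have UU: "transpose U ** U = mat 1" "U ** transpose U = mat 1"
    using U by (auto simp: orthogonal_matrix_def)
  have quad: "x \<bullet> ((U ** diag_matrix k ** transpose U) *v x) = (\<Sum>i\<in>UNIV. k i * ((transpose U *v x) $ i)\<^sup>2)"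
    for k x
  proof -
    have "x \<bullet> ((U ** diag_matrix k ** transpose U) *v x)
      = x \<bullet> (U *v (diag_matrix k *v (transpose U *v x)))"
      by (simp only: matrix_vector_mul_assoc matrix_mul_assoc)
    also have "\<dots> = (transpose U *v x) \<bullet> (diag_matrix k *v (transpose U *v x))"
      by (simp only: inner_matrix_vector_transpose transpose_transpose)
    finally show ?thesis
      by (simp add: inner_vec_def diag_matrix_vector power2_eq_square mult_ac del: vector_transpose_matrix)
  qed
  \<comment> \<open>The quadratic form of \<open>A\<close> takes the value \<open>l i\<close> at the
    nonzero vector \<open>U e_i\<close>.\<close>
  have l: "l i > 0" for i
  proof -
    have tU: "transpose U *v (U *v axis i 1) = axis i 1"
      by (simp add: matrix_vector_mul_assoc UU)
    have "U *v axis i 1 \<noteq> 0"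
    proof
      assume "U *v axis i 1 = 0"
      then have "axis i (1::real) = (0 :: real^'n)" using tU by (metis matrix_vector_mult_0_right)
      then show False by (simp add: axis_eq_0_iff)
    qed
    then have "0 < (U *v axis i 1) \<bullet> (A *v (U *v axis i 1))"
      using assms by (simp add: pos_def_def)
    also have "\<dots> = l i"
      unfolding A quad tU by (simp add: axis_def if_distrib[of "\<lambda>x. x\<^sup>2"] if_distrib[of "\<lambda>x. _ * x"] cong: if_cong)
    finally show ?thesis .
  qed
  let ?B = "U ** diag_matrix (\<lambda>i. sqrt (l i)) ** transpose U"
  have "transpose ?B = ?B"
    by (simp add: matrix_transpose_mul transpose_diag_matrix matrix_mul_assoc)
  moreover have "0 < x \<bullet> (?B *v x)" if "x \<noteq> 0" for x
  proof -
    have "transpose U *v x \<noteq> 0"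
    proof
      assume "transpose U *v x = 0"
      then have "U *v (transpose U *v x) = 0" by simp
      then show False using that by (simp only: matrix_vector_mul_assoc UU matrix_vector_mul_lid)
    qed
    then obtain i where i: "(transpose U *v x) $ i \<noteq> 0" by (auto simp: vec_eq_iff)
    have "0 < (\<Sum>i\<in>UNIV. sqrt (l i) * ((transpose U *v x) $ i)\<^sup>2)"
      by (rule sum_pos2[of _ i])
        (use i l in \<open>simp_all add: less_imp_le del: vector_transpose_matrix\<close>)
    then show ?thesis unfolding quad .
  qed
  moreover have "?B ** ?B = A"
  proof -
    have "?B ** ?B = U ** diag_matrix (\<lambda>i. sqrt (l i)) ** (transpose U ** U) ** diag_matrix (\<lambda>i. sqrt (l i)) ** transpose U"
      by (simp add: matrix_mul_assoc)
    also have "\<dots> = U ** (diag_matrix (\<lambda>i. sqrt (l i)) ** diag_matrix (\<lambda>i. sqrt (l i))) ** transpose U"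
      by (simp add: UU matrix_mul_assoc)
    finally show ?thesis using l by (simp add: diag_matrix_mult A less_imp_le)
  qed
  ultimately show ?thesis unfolding pos_def_def by blast
qed

text \<open>Writing the trace as a sum of values of the quadratic form of \<open>S\<close> lets
  definiteness control it; this serves the uniqueness of the square root.\<close>

lemma trace_congruence:
  fixes E :: "real^'n^'n"
  assumes "transpose E = E"
  shows "trace (E ** S ** E) = (\<Sum>i\<in>UNIV. (E *v axis i 1) \<bullet> (S *v (E *v axis i 1)))"
proof -
  have "(E ** S ** E) $ i $ i = (E *v axis i 1) \<bullet> (S *v (E *v axis i 1))" for i
  proof -
    have "(E ** S ** E) $ i $ i = axis i 1 \<bullet> ((E ** S ** E) *v axis i 1)"
      by (simp add: inner_axis' matrix_vector_mul_component row_def inner_axis matrix_vector_mult_basis column_def)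
    also have "\<dots> = (E *v axis i 1) \<bullet> (S *v (E *v axis i 1))"
      by (simp add: matrix_vector_mul_assoc[symmetric] symmetric_inner_swap[OF assms])
    finally show ?thesis .
  qed
  then show ?thesis by (simp add: trace_def)
qed

text \<open>For \<open>E = B - D\<close> one has \<open>E B = - D E\<close>, so the trace of the positive semidefinite
  matrix \<open>E (B + D) E\<close> vanishes.\<close>

lemma pos_def_square_root_unique:
  fixes B D :: "real^'n^'n"
  assumes B: "pos_def B" and D: "pos_def D" and eq: "B ** B = D ** D"
  shows "B = D"
proof -
  define E where "E = B - D"
  have E: "transpose E = E"
  proof -
    have "transpose E = transpose B - transpose D" by (simp add: E_def transpose_def vec_eq_iff)
    then show ?thesis using B D by (simp add: pos_def_def E_def)
  qed
  have EB: "E ** B = - (D ** E)"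
    using eq by (simp add: E_def matrix_sub_ldistrib matrix_sub_rdistrib)
  have "trace (E ** B ** E) = trace (E ** (E ** B))" by (rule trace_mul_sym)
  also have "\<dots> = - trace (E ** D ** E)"
    unfolding EB by (simp only: matrix_mul_uminus_right trace_uminus matrix_mul_assoc)
  finally have "trace (E ** B ** E) = - trace (E ** D ** E)" .
  then have "trace (E ** B ** E) + trace (E ** D ** E) = 0" by simp
  then have sum0: "(\<Sum>i\<in>UNIV. (E *v axis i 1) \<bullet> (B *v (E *v axis i 1)) + (E *v axis i 1) \<bullet> (D *v (E *v axis i 1))) = 0"
    by (simp add: trace_congruence[OF E] sum.distrib)
  have pos: "x \<bullet> (B *v x) \<ge> 0" "x \<bullet> (D *v x) \<ge> 0" for x
    using B D by (cases "x = 0"; simp add: pos_def_def less_imp_le)+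
  have "E *v axis i 1 = 0" for i
  proof (rule ccontr)
    assume "E *v axis i 1 \<noteq> 0"
    then have "0 < (E *v axis i 1) \<bullet> (B *v (E *v axis i 1))" using B by (simp add: pos_def_def)
    moreover have "(E *v axis i 1) \<bullet> (B *v (E *v axis i 1)) + (E *v axis i 1) \<bullet> (D *v (E *v axis i 1)) = 0"
    proof -
      have "\<forall>i\<in>UNIV. (E *v axis i 1) \<bullet> (B *v (E *v axis i 1)) + (E *v axis i 1) \<bullet> (D *v (E *v axis i 1)) = 0"
        using sum0 pos by (intro sum_nonneg_eq_0_iff[THEN iffD1]) (auto intro: add_nonneg_nonneg)
      then show ?thesis by blast
    qed
    ultimately show False using pos(2)[of "E *v axis i 1"] by linarith
  qed
  then have "E = 0" by (simp add: matrix_vector_mult_basis column_def vec_eq_iff)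
  then show ?thesis by (simp add: E_def)
qed

text \<open>Existence and uniqueness together unlock the definite description in
  \<open>matrix_sqrt\<close>.\<close>

lemma matrix_sqrt_pos_def:
  assumes "pos_def A"
  shows pos_def_matrix_sqrt: "pos_def (matrix_sqrt A)"
    and matrix_sqrt_square: "matrix_sqrt A ** matrix_sqrt A = A"
proof -
  have "\<exists>!B. pos_def B \<and> B ** B = A"
  proof (rule ex_ex1I)
    show "\<exists>B. pos_def B \<and> B ** B = A" by (rule pos_def_square_root_exists[OF assms])
    show "B = D" if "pos_def B \<and> B ** B = A" "pos_def D \<and> D ** D = A" for B D
      by (rule pos_def_square_root_unique) (use that in simp_all)
  qed
  note theI'[OF this, folded matrix_sqrt_def]
  then show "pos_def (matrix_sqrt A)" "matrix_sqrt A ** matrix_sqrt A = A" by simp_all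
qed

section \<open>Inverses of positive definite matrices\<close>

lemma pos_def_invertible:
  fixes A :: "real^'n^'n"
  assumes "pos_def A"
  shows "invertible A"
proof -
  have "x = 0" if "A *v x = 0" for x
  proof (rule ccontr)
    assume "x \<noteq> 0"
    then have "0 < x \<bullet> (A *v x)" using assms by (simp add: pos_def_def)
    then show False using that by simp
  qed
  then show ?thesis
    unfolding invertible_left_inverse matrix_left_invertible_ker by simp
qed

lemma matrix_inv_unique:
  fixes A B :: "real^'n^'n"
  assumes "A ** B = mat 1"
  shows "matrix_inv A = B"
proof -
  have "invertible A" unfolding invertible_right_inverse using assms by blast
  then have "matrix_inv A ** (A ** B) = B" by (simp only: matrix_mul_assoc matrix_inv_left matrix_mul_lid)
  then show ?thesis using assms by simp
qed

lemma transpose_matrix_inv_sym: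
  fixes A :: "real^'n^'n"
  assumes "invertible A" "transpose A = A"
  shows "transpose (matrix_inv A) = matrix_inv A"
proof -
  have "A ** transpose (matrix_inv A) = transpose (matrix_inv A ** A)"
    using assms(2) by (simp add: matrix_transpose_mul)
  also have "\<dots> = mat 1" using assms(1) by (simp add: matrix_inv_left)
  finally show ?thesis by (rule matrix_inv_unique[symmetric])
qed

lemma matrix_inv_square:
  fixes L :: "real^'n^'n"
  assumes "invertible L"
  shows "matrix_inv L ** matrix_inv L = matrix_inv (L ** L)"
proof -
  have "(L ** L) ** (matrix_inv L ** matrix_inv L) = L ** (L ** matrix_inv L) ** matrix_inv L"
    by (simp only: matrix_mul_assoc)
  then have "(L ** L) ** (matrix_inv L ** matrix_inv L) = mat 1"
    by (simp add: matrix_inv_right[OF assms])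
  then show ?thesis by (rule matrix_inv_unique[symmetric])
qed

lemma matrix_inv_sqrt_square:
  assumes "pos_def A"
  shows "matrix_inv_sqrt A ** matrix_inv_sqrt A = matrix_inv A"
  using matrix_inv_square[OF pos_def_invertible[OF pos_def_matrix_sqrt[OF assms]]]
  by (simp add: matrix_inv_sqrt_def matrix_sqrt_square[OF assms])

section \<open>Lebesgue and Gaussian measure under linear maps\<close>

lemma orthogonal_transformation_vimage_ball:
  fixes T :: "'a::euclidean_space \<Rightarrow> 'a"
  assumes T: "orthogonal_transformation T"
  shows "\<exists>c'. T -` ball c r = ball c' r"
proof -
  obtain c' where c': "c = T c'"
    using orthogonal_transformation_surj[OF T] by (metis surjD)
  have "dist (T c') (T x) = dist c' x" for x
    using T by (simp add: dist_norm orthogonal_transformation linear_diff[symmetric])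
  then show ?thesis by (intro exI[of _ c']) (auto simp: c')
qed

text \<open>An open set is a countable disjoint union of balls up to a null set (Vitali), and balls are
  mapped to balls of the same radius.\<close>

lemma emeasure_lborel_open_le_vimage:
  fixes T :: "'a::euclidean_space \<Rightarrow> 'a"
  assumes T: "orthogonal_transformation T" and S: "open S"
  shows "emeasure lborel S \<le> emeasure lborel (T -` S)"
proof -
  define K where "K = {(c, r). 0 < r \<and> ball c r \<subseteq> S}"
  have cover: "\<exists>i. i \<in> K \<and> x \<in> ball (fst i) (snd i) \<and> snd i < d" if x: "x \<in> S" and d: "0 < d" for x d
  proof -
    obtain e where e: "e > 0" "ball x e \<subseteq> S" using S x openE by blast
    have "ball x (min e (d / 2)) \<subseteq> S" using e(2) by auto
    then show ?thesis using e d by (intro exI[of _ "(x, min e (d / 2))"]) (auto simp: K_def)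
  qed
  obtain C where C: "countable C" "C \<subseteq> K"
    and disj: "pairwise (\<lambda>i j. disjnt (ball (fst i) (snd i)) (ball (fst j) (snd j))) C"
    and neg: "negligible (S - (\<Union>i\<in>C. ball (fst i) (snd i)))"
    by (rule Vitali_covering_theorem_balls[of S K fst snd, OF cover])
  define B where "B i = ball (fst i) (snd i)" for i :: "'a \<times> real"
  have B: "B i \<in> sets lborel" "T -` B i \<in> sets lborel" "emeasure lborel (T -` B i) = emeasure lborel (B i)"
    if "i \<in> C" for i
  proof -
    obtain c' where "T -` B i = ball c' (snd i)"
      unfolding B_def using orthogonal_transformation_vimage_ball[OF T] by blast
    moreover have "snd i \<ge> 0" using that C(2) by (auto simp: K_def)
    ultimately show "B i \<in> sets lborel" "T -` B i \<in> sets lborel" "emeasure lborel (T -` B i) = emeasure lborel (B i)"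
      by (simp_all add: B_def emeasure_ball)
  qed
  have disjB: "disjoint_family_on B C"
    using disj by (simp add: disjoint_family_on_def pairwise_def disjnt_def B_def)
  then have disjTB: "disjoint_family_on (\<lambda>i. T -` B i) C"
    unfolding disjoint_family_on_def by blast
  have TS: "T -` S \<in> sets lborel"
    using S T by (simp add: continuous_open_vimage linear_continuous_at linear_conv_bounded_linear orthogonal_transformation)
  have UB: "(\<Union>i\<in>C. B i) \<in> sets lborel" using B C(1) by (intro sets.countable_UN') auto
  have "S - (\<Union>i\<in>C. B i) \<in> null_sets lborel"
    using neg S UB by (simp add: B_def negligible_iff_null_sets null_sets_completion_iff)
  then have "emeasure lborel S = emeasure lborel (S - (S - (\<Union>i\<in>C. B i)))"
    using S by (subst emeasure_Diff_null_set) auto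
  also have "\<dots> \<le> emeasure lborel (\<Union>i\<in>C. B i)"
    using UB by (intro emeasure_mono) auto
  also have "\<dots> = (\<integral>\<^sup>+i. emeasure lborel (B i) \<partial>count_space C)"
    using B C disjB by (intro emeasure_UN_countable) auto
  also have "\<dots> = (\<integral>\<^sup>+i. emeasure lborel (T -` B i) \<partial>count_space C)"
    using B by (intro nn_integral_cong) auto
  also have "\<dots> = emeasure lborel (\<Union>i\<in>C. T -` B i)"
    using B C disjTB by (intro emeasure_UN_countable[symmetric]) auto
  also have "\<dots> \<le> emeasure lborel (T -` S)"
  proof (rule emeasure_mono)
    have "B i \<subseteq> S" if "i \<in> C" for i using subsetD[OF C(2) that] by (auto simp: K_def B_def)
    then show "(\<Union>i\<in>C. T -` B i) \<subseteq> T -` S" by blast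
  qed (rule TS)
  finally show ?thesis .
qed

text \<open>The inequality for open sets, used for \<open>T\<close> and for its inverse, becomes an
  equality on boxes, and a Borel measure with the right volumes of boxes is
  \<open>lborel\<close>.\<close>

lemma lborel_distr_orthogonal_transformation:
  fixes T :: "'a::euclidean_space \<Rightarrow> 'a"
  assumes T: "orthogonal_transformation T"
  shows "distr lborel borel T = lborel"
proof -
  have inv: "orthogonal_transformation (inv T)" by (rule orthogonal_transformation_inv[OF T])
  have cont: "continuous_on UNIV T"
    using T by (simp add: linear_continuous_on linear_conv_bounded_linear orthogonal_transformation)
  have [measurable]: "T \<in> borel_measurable borel"
    using cont by (rule borel_measurable_continuous_onI)
  have "lborel = distr lborel borel T"
  proof (rule lborel_eqI)
    fix l u :: 'a assume lu: "\<And>b. b \<in> Basis \<Longrightarrow> l \<bullet> b \<le> u \<bullet> b"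
    have "open (T -` box l u)" using cont by (simp add: open_vimage open_box)
    then have "emeasure lborel (T -` box l u) \<le> emeasure lborel (inv T -` T -` box l u)"
      by (rule emeasure_lborel_open_le_vimage[OF inv])
    also have "inv T -` T -` box l u = box l u"
      using orthogonal_transformation_surj[OF T] by (auto simp: surj_f_inv_f)
    finally have "emeasure lborel (T -` box l u) = emeasure lborel (box l u)"
      using emeasure_lborel_open_le_vimage[OF T open_box, of l u] by (intro antisym) auto
    then show "emeasure (distr lborel borel T) (box l u) = (\<Prod>b\<in>Basis. (u - l) \<bullet> b)"
      using lu by (simp add: emeasure_distr emeasure_lborel_box_eq)
  qed simp
  then show ?thesis by simp
qed

lemma orthogonal_matrix_orthogonal_transformation:
  "orthogonal_matrix (U :: real^'n^'n) \<Longrightarrow> orthogonal_transformation ((*v) U)"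
  by (simp add: orthogonal_transformation_matrix)

lemma borel_measurable_matrix [measurable]: "(*v) (A :: real^'n^'m) \<in> borel_measurable borel"
  by (intro borel_measurable_continuous_onI matrix_vector_mult_linear_continuous_on)

lemma borel_measurable_matrix_vector_mult [measurable]:
  fixes A :: "real^'n^'m"
  shows "f \<in> borel_measurable M \<Longrightarrow> (\<lambda>x. A *v f x) \<in> borel_measurable M"
  by (rule measurable_compose[OF _ borel_measurable_matrix])

lemma prod_Basis_cart:
  "(\<Prod>b\<in>(Basis :: (real^'n) set). f b) = (\<Prod>i\<in>UNIV. f (axis i 1))"
proof -
  have B: "(Basis :: (real^'n) set) = range (\<lambda>i. axis i 1)"
    by (auto simp: Basis_vec_def)
  have inj: "inj (\<lambda>i :: 'n. axis i (1::real))" by (auto simp: inj_def axis_eq_axis)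
  show ?thesis unfolding B prod.reindex[OF inj] o_def ..
qed

lemma det_diag_matrix: "det (diag_matrix l :: real^'n^'n) = (\<Prod>i\<in>UNIV. l i)"
  by (subst det_diagonal) (auto simp: diag_matrix_def)

lemma lborel_diag_matrix:
  fixes l :: "'n::finite \<Rightarrow> real"
  assumes "\<And>i. l i \<noteq> 0"
  shows "lborel = density (distr lborel borel ((*v) (diag_matrix l))) (\<lambda>_. ennreal \<bar>det (diag_matrix l :: real^'n^'n)\<bar>)"
proof -
  \<comment> \<open>\<open>c b\<close> reads the diagonal entry off the basis vector
    \<open>b\<close>, which puts the map into the form of a coordinatewise scaling of a euclidean
    space.\<close>
  define c :: "real^'n \<Rightarrow> real" where "c b = b \<bullet> (diag_matrix l *v b)" for b
  have c: "c (axis i 1) = l i" for i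
    by (simp add: c_def inner_axis' diag_matrix_vector)
  have "(*v) (diag_matrix l) = (\<lambda>x. 0 + (\<Sum>j\<in>Basis. (c j * (x \<bullet> j)) *\<^sub>R j))"
  proof (rule ext, rule euclidean_eqI)
    fix x b :: "real^'n" assume b: "b \<in> Basis"
    then obtain i where i: "b = axis i 1" by (auto simp: Basis_vec_def)
    have "(diag_matrix l *v x) \<bullet> b = c b * (x \<bullet> b)"
      by (simp add: i c inner_axis diag_matrix_vector)
    then show "(diag_matrix l *v x) \<bullet> b = (0 + (\<Sum>j\<in>Basis. (c j * (x \<bullet> j)) *\<^sub>R j)) \<bullet> b"
      using b by (simp add: inner_sum_left_Basis)
  qed
  moreover have "lborel = density (distr lborel borel (\<lambda>x. 0 + (\<Sum>j\<in>Basis. (c j * (x \<bullet> j)) *\<^sub>R j)))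
      (\<lambda>_. ennreal (\<Prod>j\<in>Basis. \<bar>c j\<bar>))"
    by (rule lborel_affine_euclidean) (use assms c in \<open>auto simp: Basis_vec_def\<close>)
  ultimately show ?thesis
    by (simp add: prod_Basis_cart c det_diag_matrix abs_prod)
qed

text \<open>After diagonalisation the two rotations preserve \<open>lborel\<close>, so only the
  coordinatewise scaling contributes a Jacobian. Symmetric maps suffice because the whitening is
  done with the symmetric root of the covariance.\<close>

lemma lborel_symmetric_matrix:
  fixes L :: "real^'n^'n"
  assumes "transpose L = L" and "det L \<noteq> 0"
  shows "lborel = density (distr lborel borel ((*v) L)) (\<lambda>_. ennreal \<bar>det L\<bar>)"
proof -
  obtain U l where U: "orthogonal_matrix U" and L: "L = U ** diag_matrix l ** transpose U"
    using symmetric_matrix_diagonalization[OF assms(1)] by blast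
  let ?D = "diag_matrix l :: real^'n^'n" and ?U = "transpose U"
  have "det U * det ?U = 1"
    using U det_mul[of U ?U] by (simp add: orthogonal_matrix_def)
  then have det: "det L = det ?D" by (simp add: L det_mul)
  then have nz: "l i \<noteq> 0" for i using assms(2) by (simp add: det_diag_matrix)
  have dU: "distr lborel borel ((*v) U) = lborel" and dU': "distr lborel borel ((*v) ?U) = lborel"
    using U by (auto intro!: lborel_distr_orthogonal_transformation orthogonal_matrix_orthogonal_transformation)
  let ?c = "\<lambda>_. ennreal \<bar>det L\<bar>"
  have "lborel = distr lborel borel ((*v) U)" by (simp add: dU)
  also have "\<dots> = distr (density (distr lborel borel ((*v) ?D)) ?c) borel ((*v) U)"
    using lborel_diag_matrix[of l, OF nz] by (simp only: det)
  also have "\<dots> = density (distr (distr (distr lborel borel ((*v) ?U)) borel ((*v) ?D)) borel ((*v) U)) ?c"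
    by (simp add: density_distr dU')
  also have "distr (distr (distr lborel borel ((*v) ?U)) borel ((*v) ?D)) borel ((*v) U) = distr lborel borel ((*v) L)"
  proof -
    have "(*v) U \<circ> ((*v) ?D \<circ> (*v) ?U) = (*v) L"
      by (simp only: fun_eq_iff o_apply L matrix_vector_mul_assoc matrix_mul_assoc simp_thms)
    moreover have lb: "(*v) B \<in> borel_measurable lborel" for B :: "real^'n^'n"
      by measurable
    moreover have "(*v) ?D \<circ> (*v) ?U \<in> borel_measurable lborel"
      by (rule measurable_comp[OF lb borel_measurable_matrix])
    ultimately show ?thesis
      by (simp only: distr_distr[OF borel_measurable_matrix])
  qed
  finally show ?thesis .
qed

section \<open>The standard Gaussian measure and its linear images\<close>

text \<open>The product form makes integrals factorise over coordinates;
  \<open>std_gauss_density_eq\<close> supplies the form that exhibits rotation invariance.\<close>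

definition std_gauss_density :: "real^'n \<Rightarrow> real" where
  "std_gauss_density x = (\<Prod>i\<in>UNIV. std_normal_density (x $ i))"

definition std_gauss :: "(real^'n) measure" where
  "std_gauss = density lborel (\<lambda>x. ennreal (std_gauss_density x))"

lemma borel_measurable_std_gauss_density [measurable]: "std_gauss_density \<in> borel_measurable borel"
  unfolding std_gauss_density_def by measurable

lemma sets_std_gauss [measurable_cong, simp]: "sets std_gauss = sets borel"
  and space_std_gauss [simp]: "space std_gauss = UNIV"
  by (simp_all add: std_gauss_def)

lemma std_gauss_density_eq:
  fixes x :: "real^'n"
  shows "std_gauss_density x = (2 * pi) powr (- real CARD('n) / 2) * exp (- (x \<bullet> x) / 2)"
proof -
  have "std_gauss_density x = (\<Prod>i\<in>(UNIV :: 'n set). 1 / sqrt (2 * pi)) * (\<Prod>i\<in>UNIV. exp (- (x $ i)\<^sup>2 / 2))"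
    unfolding std_gauss_density_def std_normal_density_def by (rule prod.distrib)
  also have "(\<Prod>i\<in>(UNIV :: 'n set). 1 / sqrt (2 * pi)) = ((2 * pi) powr (- 1 / 2)) ^ CARD('n)"
    by (simp add: powr_minus powr_half_sqrt inverse_eq_divide)
  also have "\<dots> = (2 * pi) powr (- real CARD('n) / 2)"
    by (simp add: powr_power)
  also have "(\<Prod>i\<in>UNIV. exp (- (x $ i)\<^sup>2 / 2)) = exp (- (x \<bullet> x) / 2)"
    by (simp add: exp_sum[symmetric] inner_vec_def sum_negf sum_divide_distrib power2_eq_square)
  finally show ?thesis .
qed

text \<open>Tonelli over the coordinates. With values in \<open>ennreal\<close> it presupposes no
  integrability and can therefore be used to establish it.\<close>

lemma nn_integral_std_gauss_prod:
  fixes f :: "'n::finite \<Rightarrow> real \<Rightarrow> ennreal"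
  assumes [measurable]: "\<And>i. f i \<in> borel_measurable borel"
  shows "(\<integral>\<^sup>+x. (\<Prod>i\<in>UNIV. f i (x $ i)) \<partial>(std_gauss :: (real^'n) measure))
    = (\<Prod>i\<in>UNIV. \<integral>\<^sup>+x. f i x * ennreal (std_normal_density x) \<partial>lborel)"
proof -
  \<comment> \<open>The inverse of \<open>i \<mapsto> axis i 1\<close>, to pass between products
    over \<open>Basis\<close> and products over indices.\<close>
  define ix :: "real^'n \<Rightarrow> 'n" where "ix b = (SOME i. b = axis i 1)" for b
  have ix: "ix (axis i 1) = i" for i
    unfolding ix_def by (rule some_equality) (auto simp: axis_eq_axis)
  define F where "F b x = f (ix b) x * ennreal (std_normal_density x)" for b x
  have [measurable]: "F b \<in> borel_measurable borel" for b unfolding F_def by measurable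
  have "(\<integral>\<^sup>+x. (\<Prod>i\<in>UNIV. f i (x $ i)) \<partial>(std_gauss :: (real^'n) measure))
      = (\<integral>\<^sup>+x. (\<Prod>b\<in>Basis. F b (x \<bullet> b)) \<partial>(lborel :: (real^'n) measure))"
    by (simp add: std_gauss_def nn_integral_density prod_Basis_cart F_def ix inner_axis
        std_gauss_density_def prod.distrib prod_ennreal[symmetric] mult.commute)
  also have "\<dots> = (\<Prod>b\<in>(Basis :: (real^'n) set). \<integral>\<^sup>+x. F b x \<partial>lborel)"
    by (rule nn_integral_lborel_prod) auto
  finally show ?thesis by (simp add: prod_Basis_cart F_def ix)
qed

lemma prob_space_std_gauss: "prob_space std_gauss"
proof
  have "(\<integral>\<^sup>+x. ennreal (std_normal_density x) \<partial>lborel) = 1"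
    using prob_space_normal_density[of 1 0] unfolding prob_space_def prob_space_axioms_def
    by (simp add: emeasure_density)
  then have "(\<integral>\<^sup>+x. (\<Prod>i\<in>(UNIV::'n set). 1) \<partial>(std_gauss :: (real^'n) measure)) = 1"
    by (subst nn_integral_std_gauss_prod[where f="\<lambda>_ _. 1"]) simp_all
  then show "emeasure (std_gauss :: (real^'n) measure) (space std_gauss) = 1" by simp
qed

lemma std_gauss_density_orthogonal:
  fixes T :: "real^'n \<Rightarrow> real^'n"
  shows "orthogonal_transformation T \<Longrightarrow> std_gauss_density (T x) = std_gauss_density x"
  by (simp add: std_gauss_density_eq orthogonal_transformation_def)

lemma borel_measurable_orthogonal_transformation:
  fixes T :: "'a::euclidean_space \<Rightarrow> 'a"
  assumes "orthogonal_transformation T"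
  shows "T \<in> borel_measurable borel"
  using assms linear_continuous_on[of T UNIV]
  by (intro borel_measurable_continuous_onI) (simp add: linear_conv_bounded_linear orthogonal_transformation)

lemma std_gauss_orthogonal:
  fixes T :: "real^'n \<Rightarrow> real^'n"
  assumes T: "orthogonal_transformation T"
  shows "distr std_gauss borel T = std_gauss"
proof -
  have [measurable]: "T \<in> borel_measurable borel" by (rule borel_measurable_orthogonal_transformation[OF T])
  have "std_gauss = density (distr lborel borel T) (\<lambda>x. ennreal (std_gauss_density x))"
    by (simp add: std_gauss_def lborel_distr_orthogonal_transformation[OF T])
  also have "\<dots> = distr std_gauss borel T"
    by (simp add: density_distr std_gauss_density_orthogonal[OF T] std_gauss_def)
  finally show ?thesis by simp
qed

lemma pos_def_det_pos:
  assumes "pos_def L"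
  shows "0 < det L"
proof -
  have "det (matrix_sqrt L) \<noteq> 0"
    using pos_def_invertible[OF pos_def_matrix_sqrt[OF assms]] invertible_det_nz by blast
  moreover have "det L = det (matrix_sqrt L) * det (matrix_sqrt L)"
    using det_mul[of "matrix_sqrt L" "matrix_sqrt L"] by (simp add: matrix_sqrt_square[OF assms])
  ultimately show ?thesis by (simp add: zero_less_mult_iff) linarith
qed

text \<open>Sandwiched between two factors \<open>L\<close>, the inverse of \<open>L ** L\<close>
  becomes the identity, which leaves the exponent \<open>z \<bullet> z\<close>; the Jacobian
  \<open>det L\<close> cancels the normalising factor
  \<open>det (L ** L) powr (- 1 / 2)\<close>.\<close>

lemma normal_vec_density_std_gauss:
  fixes L :: "real^'n^'n"
  assumes "pos_def L"
  shows "det L * normal_vec_density 0 (L ** L) (L *v z) = std_gauss_density z"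
proof -
  note inv = pos_def_invertible[OF assms]
  define P where "P = matrix_inv (L ** L)"
  have "L ** P ** L = (L ** matrix_inv L) ** (matrix_inv L ** L)"
    unfolding P_def matrix_inv_square[OF inv, symmetric] by (simp only: matrix_mul_assoc)
  then have LPL: "L ** P ** L = mat 1"
    by (simp only: matrix_inv_right[OF inv] matrix_inv_left[OF inv] matrix_mul_lid)
  have "(L *v z) \<bullet> (P *v (L *v z)) = z \<bullet> (L *v (P *v (L *v z)))"
    using symmetric_inner_swap[OF pos_def_transpose[OF assms], of z "P *v (L *v z)"] by (rule sym)
  also have "L *v (P *v (L *v z)) = (L ** P ** L) *v z"
    by (simp only: matrix_vector_mul_assoc matrix_mul_assoc)
  finally have q: "(L *v z) \<bullet> (matrix_inv (L ** L) *v (L *v z)) = z \<bullet> z"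
    unfolding LPL P_def[symmetric] by simp
  have "det (L ** L) powr (- 1 / 2) = 1 / det L"
    using pos_def_det_pos[OF assms]
    by (simp add: det_mul powr_minus powr_half_sqrt inverse_eq_divide)
  then show ?thesis
    using pos_def_det_pos[OF assms] by (simp add: normal_vec_density_def q std_gauss_density_eq)
qed

lemma normal_vec_density_measurable [measurable]: "normal_vec_density \<mu> \<Sigma> \<in> borel_measurable borel"
  unfolding normal_vec_density_def by measurable

lemma density_normal_vec:
  fixes L :: "real^'n^'n"
  assumes "pos_def L"
  shows "density lborel (\<lambda>x. ennreal (normal_vec_density 0 (L ** L) x)) = distr std_gauss borel ((*v) L)"
proof -
  have d: "det L > 0" by (rule pos_def_det_pos[OF assms])
  have "lborel = density (distr lborel borel ((*v) L)) (\<lambda>_. ennreal (det L))"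
    using lborel_symmetric_matrix[OF pos_def_transpose[OF assms] less_imp_neq[OF d, symmetric]]
    unfolding abs_of_pos[OF d] .
  then have "density lborel (\<lambda>x. ennreal (normal_vec_density 0 (L ** L) x)) =
    density (density (distr lborel borel ((*v) L)) (\<lambda>_. ennreal (det L))) (\<lambda>x. ennreal (normal_vec_density 0 (L ** L) x))"
    by (rule arg_cong)
  also have "\<dots> = density (distr lborel borel ((*v) L)) (\<lambda>x. ennreal (det L * normal_vec_density 0 (L ** L) x))"
    using d by (subst density_density_eq) (auto simp: ennreal_mult')
  also have "\<dots> = distr std_gauss borel ((*v) L)"
    by (simp add: density_distr normal_vec_density_std_gauss[OF assms] std_gauss_def)
  finally show ?thesis .
qed

section \<open>Expectations under elliptical errors\<close>

lemma det_scaleR_matrix: "det (c *\<^sub>R (A :: real^'n^'n)) = c ^ CARD('n) * det A"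
proof -
  have "c *\<^sub>R A = diag_matrix (\<lambda>_. c) ** A"
    by (simp add: matrix_eq matrix_vector_mul_assoc[symmetric] vec_eq_iff diag_matrix_vector
        scaleR_matrix_vector_assoc[symmetric])
  then show ?thesis by (simp add: det_mul det_diag_matrix)
qed

lemma matrix_inv_scaleR:
  fixes A :: "real^'n^'n"
  assumes "invertible A" "c \<noteq> 0"
  shows "matrix_inv (c *\<^sub>R A) = (1 / c) *\<^sub>R matrix_inv A"
proof (rule matrix_inv_unique)
  have "(c *\<^sub>R A) ** ((1 / c) *\<^sub>R matrix_inv A) = (1 / c) *\<^sub>R (c *\<^sub>R (A ** matrix_inv A))"
    by (simp only: matrix_scalar_ac scalar_matrix_assoc)
  then show "(c *\<^sub>R A) ** ((1 / c) *\<^sub>R matrix_inv A) = mat 1"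
    using assms by (simp add: matrix_inv_right)
qed

lemma pos_def_scaleR:
  assumes "pos_def A" "c > 0"
  shows "pos_def (c *\<^sub>R A)"
  unfolding pos_def_def
proof (intro conjI allI impI)
  show "transpose (c *\<^sub>R A) = c *\<^sub>R A" using pos_def_transpose[OF assms(1)] by (simp add: transpose_scalar)
  show "0 < x \<bullet> ((c *\<^sub>R A) *v x)" if "x \<noteq> 0" for x
    using that assms by (simp add: scaleR_matrix_vector_assoc[symmetric] pos_def_def)
qed

lemma normal_vec_density_nonneg: "0 \<le> normal_vec_density \<mu> \<Sigma> x"
  by (simp add: normal_vec_density_def)

lemma normal_vec_density_scaled:
  fixes \<Sigma> :: "real^'n^'n"
  assumes "invertible \<Sigma>" "t > 0"
  shows "normal_vec_density 0 ((1 / t) *\<^sub>R \<Sigma>) x =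
    (2 * pi) powr (- real CARD('n) / 2) * ((1 / t) ^ CARD('n) * det \<Sigma>) powr (- 1 / 2) *
    exp (- (t * (x \<bullet> (matrix_inv \<Sigma> *v x))) / 2)"
  using assms
  by (simp add: normal_vec_density_def det_scaleR_matrix matrix_inv_scaleR scaleR_matrix_vector_assoc[symmetric])

text \<open>The covariance \<open>(1 / t) L L\<close> belongs to the vector
  \<open>L z / sqrt t\<close>, and homogeneity of degree 2 turns the scale \<open>1 / sqrt t\<close>
  into the factor \<open>1 / t\<close>.\<close>

lemma normal_vec_density_homogeneous_expectation:
  fixes h :: "real^'n \<Rightarrow> real"
  assumes L: "pos_def L" and t: "t > 0" and [measurable]: "h \<in> borel_measurable borel"
    and hom: "\<forall>c x. c > 0 \<longrightarrow> h (c *\<^sub>R x) = c\<^sup>2 * h x"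
    and int: "integrable std_gauss (\<lambda>z. h (L *v z))"
  shows "integrable lborel (\<lambda>x. normal_vec_density 0 ((1 / t) *\<^sub>R (L ** L)) x * h x)"
    and "(\<integral>x. normal_vec_density 0 ((1 / t) *\<^sub>R (L ** L)) x * h x \<partial>lborel)
      = 1 / t * (\<integral>z. h (L *v z) \<partial>std_gauss)"
proof -
  define c where "c = 1 / sqrt t"
  have c: "c > 0" "c\<^sup>2 = 1 / t" using t by (simp_all add: c_def power_divide)
  have "(c *\<^sub>R L) ** (c *\<^sub>R L) = c *\<^sub>R (c *\<^sub>R (L ** L))"
    by (simp only: matrix_scalar_ac scalar_matrix_assoc)
  then have eq: "(1 / t) *\<^sub>R (L ** L) = (c *\<^sub>R L) ** (c *\<^sub>R L)"
    using c(2) by (simp add: power2_eq_square)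
  have hc: "h ((c *\<^sub>R L) *v z) = 1 / t * h (L *v z)" for z
    using hom[rule_format, OF c(1), of "L *v z"] c(2) by (simp add: scaleR_matrix_vector_assoc[symmetric])
  note D = density_normal_vec[OF pos_def_scaleR[OF L c(1)]]
  have "integrable std_gauss (\<lambda>z. h ((c *\<^sub>R L) *v z))"
    unfolding hc using int by simp
  then have "integrable (distr std_gauss borel ((*v) (c *\<^sub>R L))) h"
    by (subst integrable_distr_eq) simp_all
  then show "integrable lborel (\<lambda>x. normal_vec_density 0 ((1 / t) *\<^sub>R (L ** L)) x * h x)"
    unfolding eq D[symmetric] by (subst (asm) integrable_density) (simp_all add: normal_vec_density_nonneg)
  have "(\<integral>x. normal_vec_density 0 ((1 / t) *\<^sub>R (L ** L)) x * h x \<partial>lborel)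
      = (\<integral>x. h x \<partial>density lborel (normal_vec_density 0 ((c *\<^sub>R L) ** (c *\<^sub>R L))))"
    unfolding eq by (subst integral_density) (simp_all add: normal_vec_density_nonneg)
  also have "\<dots> = (\<integral>z. h ((c *\<^sub>R L) *v z) \<partial>std_gauss)"
    unfolding D by (subst integral_distr) simp_all
  finally show "(\<integral>x. normal_vec_density 0 ((1 / t) *\<^sub>R (L ** L)) x * h x \<partial>lborel)
      = 1 / t * (\<integral>z. h (L *v z) \<partial>std_gauss)"
    unfolding hc by simp
qed

text \<open>Treats one part of the Jordan decomposition. For fixed \<open>t\<close> the integral of
  \<open>|h|\<close> is \<open>1 / t\<close> times a Gaussian constant, so \<open>intN\<close> is
  exactly what Fubini asks for.\<close>

lemma normal_mixture_homogeneous_expectation: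
  fixes h :: "real^'n \<Rightarrow> real" and N :: "real measure"
  assumes L: "pos_def L" and [measurable]: "h \<in> borel_measurable borel"
    and hom: "\<forall>c x. c > 0 \<longrightarrow> h (c *\<^sub>R x) = c\<^sup>2 * h x"
    and int: "integrable std_gauss (\<lambda>z. h (L *v z))"
    and sets_N: "sets N = sets (restrict_space borel {0<..})" and "finite_measure N"
    and intN: "integrable N (\<lambda>t. 1 / t)"
  shows "integrable lborel (\<lambda>x. h x * (\<integral>t. normal_vec_density 0 ((1 / t) *\<^sub>R (L ** L)) x \<partial>N))"
    and "(\<integral>x. h x * (\<integral>t. normal_vec_density 0 ((1 / t) *\<^sub>R (L ** L)) x \<partial>N) \<partial>lborel)
      = (\<integral>t. 1 / t \<partial>N) * (\<integral>z. h (L *v z) \<partial>std_gauss)"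
proof -
  interpret N: finite_measure N by fact
  interpret P: pair_sigma_finite N "lborel :: (real^'n) measure" ..
  let ?\<Sigma> = "L ** L"
  have space_N: "space N = {0<..}"
    using sets_eq_imp_space_eq[OF sets_N] by (simp add: space_restrict_space)
  have inv: "invertible ?\<Sigma>" using pos_def_invertible[OF L] by (simp add: invertible_mult)
  have [measurable]: "(\<lambda>t. t) \<in> borel_measurable N"
    unfolding measurable_cong_sets[OF sets_N refl] by (rule measurable_restrict_space1) simp
  define k where "k = (\<lambda>(t, x). normal_vec_density 0 ((1 / t) *\<^sub>R ?\<Sigma>) x * h x)"
  \<comment> \<open>Determinant and inverse of the scaled matrix are made explicit in
    \<open>t\<close>, which exposes joint measurability.\<close>
  have k_measurable: "k \<in> borel_measurable (N \<Otimes>\<^sub>M lborel)"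
  proof -
    have "(\<lambda>p. (2 * pi) powr (- real CARD('n) / 2) * ((1 / fst p) ^ CARD('n) * det ?\<Sigma>) powr (- 1 / 2) *
      exp (- (fst p * (snd p \<bullet> (matrix_inv ?\<Sigma> *v snd p))) / 2) * h (snd p)) \<in> borel_measurable (N \<Otimes>\<^sub>M lborel)"
      by measurable
    then show ?thesis
      by (rule measurable_cong[THEN iffD1, rotated])
        (auto simp: k_def space_pair_measure space_N normal_vec_density_scaled[OF inv])
  qed
  have habs: "integrable std_gauss (\<lambda>z. \<bar>h (L *v z)\<bar>)" using int by (rule integrable_abs)
  have int_k: "integrable (N \<Otimes>\<^sub>M lborel) k"
  proof (rule P.Fubini_integrable[OF k_measurable])
    have "(\<integral>x. norm (k (t, x)) \<partial>lborel) = 1 / t * (\<integral>z. \<bar>h (L *v z)\<bar> \<partial>std_gauss)" if "t \<in> space N" for t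
      using normal_vec_density_homogeneous_expectation(2)[OF L, of t "\<lambda>x. \<bar>h x\<bar>"] that habs hom
      by (simp add: k_def abs_mult normal_vec_density_nonneg space_N)
    moreover have "integrable N (\<lambda>t. 1 / t * (\<integral>z. \<bar>h (L *v z)\<bar> \<partial>std_gauss))"
      using intN by (intro integrable_mult_left)
    ultimately show "integrable N (\<lambda>t. \<integral>x. norm (k (t, x)) \<partial>lborel)"
      by (simp only: cong: Bochner_Integration.integrable_cong)
    show "AE t in N. integrable lborel (\<lambda>x. k (t, x))"
      using normal_vec_density_homogeneous_expectation(1)[OF L _ assms(2) hom int]
      by (intro AE_I2) (simp add: k_def space_N)
  qed
  then have int_k': "integrable (N \<Otimes>\<^sub>M lborel) (case_prod (\<lambda>t x. k (t, x)))" by simp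
  \<comment> \<open>Valid for every \<open>x\<close>, also where the mixture integral diverges: if
    \<open>h x\<close> is nonzero both integrals are then 0 by convention, and otherwise both sides
    vanish anyway.\<close>
  have k_int: "(\<integral>t. k (t, x) \<partial>N) = h x * (\<integral>t. normal_vec_density 0 ((1 / t) *\<^sub>R ?\<Sigma>) x \<partial>N)" for x
    by (simp add: k_def mult.commute)
  show "integrable lborel (\<lambda>x. h x * (\<integral>t. normal_vec_density 0 ((1 / t) *\<^sub>R ?\<Sigma>) x \<partial>N))"
    using P.integrable_snd[OF int_k'] by (simp add: k_int)
  have "(\<integral>x. h x * (\<integral>t. normal_vec_density 0 ((1 / t) *\<^sub>R ?\<Sigma>) x \<partial>N) \<partial>lborel)
    = (\<integral>t. (\<integral>x. k (t, x) \<partial>lborel) \<partial>N)"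
    using P.integral_snd[OF int_k'] P.integral_fst[OF int_k'] by (simp add: k_int)
  also have "\<dots> = (\<integral>t. 1 / t * (\<integral>z. h (L *v z) \<partial>std_gauss) \<partial>N)"
    using normal_vec_density_homogeneous_expectation(2)[OF L _ assms(2) hom int]
    by (intro Bochner_Integration.integral_cong) (simp_all add: k_def space_N)
  finally show "(\<integral>x. h x * (\<integral>t. normal_vec_density 0 ((1 / t) *\<^sub>R ?\<Sigma>) x \<partial>N) \<partial>lborel)
      = (\<integral>t. 1 / t \<partial>N) * (\<integral>z. h (L *v z) \<partial>std_gauss)"
    by (simp only: integral_mult_left_zero)
qed

text \<open>Only the factor \<open>E[1/t]\<close> of the mixing measure survives in the expectation of a function that
  is homogeneous of degree 2, so elliptical expectations reduce to Gaussian ones.\<close>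

lemma elliptical_homogeneous_expectation:
  fixes eps :: "'w \<Rightarrow> real^'n" and h :: "real^'n \<Rightarrow> real"
  assumes L: "pos_def L" and h [measurable]: "h \<in> borel_measurable borel"
    and hom: "\<forall>c x. c > 0 \<longrightarrow> h (c *\<^sub>R x) = c\<^sup>2 * h x"
    and int: "integrable std_gauss (\<lambda>z. h (L *v z))"
    and mixing: "mixing_measure Wp Wm"
    and ell: "elliptical M eps 0 (L ** L) g"
    and mix: "normal_mixture Wp Wm (L ** L) g"
  shows "integrable M (\<lambda>\<omega>. h (eps \<omega>))"
    and "(\<integral>\<omega>. h (eps \<omega>) \<partial>M) = signed_integral Wp Wm (\<lambda>t. 1 / t) * (\<integral>z. h (L *v z) \<partial>std_gauss)"
proof -
  let ?\<Sigma> = "L ** L"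
  define f where "f x = det ?\<Sigma> powr (- 1 / 2) * g (x \<bullet> (matrix_inv ?\<Sigma> *v x))" for x
  \<comment> \<open>\<open>elliptical\<close> provides \<open>g u \<ge> 0\<close> for
    \<open>u \<ge> 0\<close> only; here the argument is the squared norm of
    \<open>L^-1 x\<close>.\<close>
  have "0 \<le> x \<bullet> (matrix_inv ?\<Sigma> *v x)" for x
  proof -
    have "x \<bullet> (matrix_inv ?\<Sigma> *v x) = (matrix_inv L *v x) \<bullet> (matrix_inv L *v x)"
      using symmetric_inner_swap[of "matrix_inv L" x "matrix_inv L *v x"]
        transpose_matrix_inv_sym[OF pos_def_invertible[OF L] pos_def_transpose[OF L]]
      by (simp add: matrix_inv_square[OF pos_def_invertible[OF L], symmetric] matrix_vector_mul_assoc[symmetric])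
    then show ?thesis by simp
  qed
  then have f_nonneg: "0 \<le> f x" for x
    using ell by (simp add: elliptical_def f_def)
  have dist: "distributed M lborel eps (\<lambda>x. ennreal (f x))"
    using ell by (simp add: elliptical_def f_def)
  have [measurable]: "f \<in> borel_measurable borel"
    using distributed_real_measurable[OF f_nonneg dist] by simp
  let ?K = "\<lambda>N x. \<integral>t. normal_vec_density 0 ((1 / t) *\<^sub>R ?\<Sigma>) x \<partial>N"
  note Wp = normal_mixture_homogeneous_expectation[OF L h hom int, of Wp]
  note Wm = normal_mixture_homogeneous_expectation[OF L h hom int, of Wm]
  have mp: "sets Wp = sets (restrict_space borel {0<..})" "finite_measure Wp" "integrable Wp (\<lambda>t. 1 / t)"
    "sets Wm = sets (restrict_space borel {0<..})" "finite_measure Wm" "integrable Wm (\<lambda>t. 1 / t)"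
    using mixing by (auto simp: mixing_measure_def jordan_pair_def)
  have AE: "AE x in lborel. f x * h x = h x * ?K Wp x - h x * ?K Wm x"
    using mix unfolding normal_mixture_def
  proof (rule AE_mp, intro AE_I2 impI)
    fix x
    assume eq: "det ?\<Sigma> powr (- 1 / 2) * g (x \<bullet> (matrix_inv ?\<Sigma> *v x)) =
      signed_integral Wp Wm (\<lambda>t. normal_vec_density 0 ((1 / t) *\<^sub>R ?\<Sigma>) x)"
    show "f x * h x = h x * ?K Wp x - h x * ?K Wm x"
      unfolding f_def eq signed_integral_def by (simp only: right_diff_distrib mult.commute[of _ "h x"])
  qed
  then have AE': "AE x in lborel. h x * ?K Wp x - h x * ?K Wm x = f x * h x" by (simp only: eq_commute)
  have int_diff: "integrable lborel (\<lambda>x. h x * ?K Wp x - h x * ?K Wm x)"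
    by (intro Bochner_Integration.integrable_diff Wp(1) Wm(1) mp)
  have fh: "(\<lambda>x. f x * h x) \<in> borel_measurable lborel" by measurable
  have "integrable lborel (\<lambda>x. f x * h x)"
    by (rule integrable_cong_AE_imp[OF int_diff fh AE'])
  then show "integrable M (\<lambda>\<omega>. h (eps \<omega>))"
    using distributed_integrable[OF dist, of h] f_nonneg by simp
  have "(\<integral>\<omega>. h (eps \<omega>) \<partial>M) = (\<integral>x. f x * h x \<partial>lborel)"
    using distributed_integral[OF dist, of h] f_nonneg by simp
  also have "\<dots> = (\<integral>x. h x * ?K Wp x - h x * ?K Wm x \<partial>lborel)"
    by (rule integral_cong_AE[OF fh borel_measurable_integrable[OF int_diff] AE])
  also have "\<dots> = (\<integral>x. h x * ?K Wp x \<partial>lborel) - (\<integral>x. h x * ?K Wm x \<partial>lborel)"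
    by (intro Bochner_Integration.integral_diff Wp(1) Wm(1) mp)
  also have "\<dots> = signed_integral Wp Wm (\<lambda>t. 1 / t) * (\<integral>z. h (L *v z) \<partial>std_gauss)"
    unfolding Wp(2)[OF mp(1-3)] Wm(2)[OF mp(4-6)] signed_integral_def by (simp add: left_diff_distrib)
  finally show "(\<integral>\<omega>. h (eps \<omega>) \<partial>M) = signed_integral Wp Wm (\<lambda>t. 1 / t) * (\<integral>z. h (L *v z) \<partial>std_gauss)" .
qed

section \<open>Gaussian moments\<close>

lemma nn_integral_std_normal_even_moment:
  "(\<integral>\<^sup>+x. ennreal (x ^ (2 * k)) * ennreal (std_normal_density x) \<partial>lborel) = ennreal (fact (2 * k) / (2 ^ k * fact k))"
proof -
  have "(\<integral>\<^sup>+x. ennreal (x ^ (2 * k)) * ennreal (std_normal_density x) \<partial>lborel)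
    = (\<integral>\<^sup>+x. ennreal (std_normal_density x * x ^ (2 * k)) \<partial>lborel)"
    by (intro nn_integral_cong) (simp add: ennreal_mult' mult.commute)
  also have "\<dots> = ennreal (fact (2 * k) / (2 ^ k * fact k))"
    using std_normal_moment_even[of k] by (subst nn_integral_eq_integral)
      (auto simp: has_bochner_integral_iff)
  finally show ?thesis .
qed

lemma nn_integral_std_normal_exp:
  assumes s: "0 \<le> s"
  shows "(\<integral>\<^sup>+x. ennreal (exp (- s * x\<^sup>2)) * ennreal (std_normal_density x) \<partial>lborel) = ennreal ((1 + 2 * s) powr (- 1 / 2))"
proof -
  \<comment> \<open>\<open>exp (- s x^2)\<close> tilts the standard normal density into
    \<open>r\<close> times the normal density with standard deviation \<open>r\<close>.\<close>
  define r where "r = 1 / sqrt (1 + 2 * s)"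
  have r: "r > 0" "r\<^sup>2 = 1 / (1 + 2 * s)" using s by (simp_all add: r_def power_divide)
  have "exp (- s * x\<^sup>2) * std_normal_density x = r * normal_density 0 r x" for x
  proof -
    have "- s * x\<^sup>2 - x\<^sup>2 / 2 = - x\<^sup>2 / (2 * r\<^sup>2)" using s by (simp add: r(2) field_simps)
    then have "exp (- s * x\<^sup>2) * exp (- x\<^sup>2 / 2) = exp (- x\<^sup>2 / (2 * r\<^sup>2))"
      by (simp add: exp_add[symmetric])
    moreover have "sqrt (2 * pi * r\<^sup>2) = r * sqrt (2 * pi)" using r(1) by (simp add: real_sqrt_mult)
    ultimately show ?thesis using r(1) by (simp add: std_normal_density_def normal_density_def field_simps)
  qed
  then have "(\<integral>\<^sup>+x. ennreal (exp (- s * x\<^sup>2)) * ennreal (std_normal_density x) \<partial>lborel)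
    = (\<integral>\<^sup>+x. ennreal r * ennreal (normal_density 0 r x) \<partial>lborel)"
    using r(1) by (intro nn_integral_cong) (simp add: ennreal_mult'[symmetric])
  also have "\<dots> = ennreal r * (\<integral>\<^sup>+x. ennreal (normal_density 0 r x) \<partial>lborel)"
    by (rule nn_integral_cmult) simp
  also have "(\<integral>\<^sup>+x. ennreal (normal_density 0 r x) \<partial>lborel) = 1"
    using prob_space.emeasure_space_1[OF prob_space_normal_density[OF r(1), of 0]]
    by (simp add: emeasure_density)
  also have "r = (1 + 2 * s) powr (- 1 / 2)"
    using s by (simp add: r_def powr_minus powr_half_sqrt inverse_eq_divide)
  finally show ?thesis by simp
qed

text \<open>The inverse of \<open>r\<close> is turned into a Laplace integral, which factorises over the coordinates.\<close>

lemma nn_integral_exp_Laplace: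
  assumes "0 < r"
  shows "(\<integral>\<^sup>+s. ennreal (exp (- s * r)) * indicator {0..} s \<partial>lborel) = ennreal (1 / r)"
proof -
  have "(\<integral>\<^sup>+s. ennreal (exp (- s * r)) * indicator {0..} s \<partial>lborel) = ennreal (0 - (- exp (- 0 * r) / r))"
  proof (rule nn_integral_FTC_atLeast)
    show "((\<lambda>s. - exp (- s * r) / r) has_real_derivative exp (- x * r)) (at x)" for x
      using assms by (auto intro!: derivative_eq_intros)
    have "((\<lambda>s. exp (- s * r)) \<longlongrightarrow> 0) at_top"
    proof (rule filterlim_compose[OF exp_at_bot])
      show "filterlim (\<lambda>s. - s * r) at_bot at_top"
        unfolding mult_minus_left filterlim_uminus_at_top[symmetric]
        by (rule filterlim_at_top_mult_tendsto_pos[OF tendsto_const assms filterlim_ident])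
    qed
    from tendsto_mult_right_zero[OF this, of "- 1 / r"]
    show "((\<lambda>s. - exp (- s * r) / r) \<longlongrightarrow> 0) at_top" by simp
  qed auto
  then show ?thesis by simp
qed

text \<open>The antiderivative is a multiple of \<open>(1 + 2 s) powr (1 - q / 2)\<close>, which
  tends to 0 at infinity because \<open>q > 2\<close>. With \<open>q\<close> the number of
  restrictions, this is where at least three of them are required.\<close>

lemma nn_integral_powr_Laplace:
  assumes "2 < q"
  shows "(\<integral>\<^sup>+s. ennreal ((1 + 2 * s) powr (- q / 2)) * indicator {0..} s \<partial>lborel) = ennreal (1 / (q - 2))"
proof -
  have "(\<integral>\<^sup>+s. ennreal ((1 + 2 * s) powr (- q / 2)) * indicator {0..} s \<partial>lborel)
    = ennreal (0 - (- ((1 + 2 * 0) powr (1 - q / 2)) / (q - 2)))"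
  proof (rule nn_integral_FTC_atLeast)
    show "((\<lambda>s. - ((1 + 2 * s) powr (1 - q / 2)) / (q - 2)) has_real_derivative (1 + 2 * x) powr (- q / 2)) (at x)"
      if "0 \<le> x" for x
    proof -
      have "((\<lambda>s. - ((1 + 2 * s) powr (1 - q / 2)) / (q - 2)) has_real_derivative
        - ((1 - q / 2) * (1 + 2 * x) powr (1 - q / 2 - 1) * 2) / (q - 2)) (at x)"
        using that assms by (auto intro!: derivative_eq_intros)
      moreover have "- ((1 - q / 2) * P * 2) / (q - 2) = P" for P
        using assms by (simp add: field_simps)
      moreover have "1 - q / 2 - 1 = - q / 2" by simp
      ultimately show ?thesis by metis
    qed
    have "((\<lambda>s::real. (1 + 2 * s) powr (1 - q / 2)) \<longlongrightarrow> 0) at_top"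
      using assms by (intro tendsto_neg_powr filterlim_tendsto_add_at_top[OF tendsto_const]
        filterlim_tendsto_pos_mult_at_top[OF tendsto_const _ filterlim_ident]) auto
    from tendsto_mult_right_zero[OF this, of "- 1 / (q - 2)"]
    show "((\<lambda>s. - ((1 + 2 * s) powr (1 - q / 2)) / (q - 2)) \<longlongrightarrow> 0) at_top" by simp
  qed auto
  then show ?thesis by simp
qed

section \<open>Squared norms of coordinate blocks\<close>

text \<open>Under \<open>std_gauss\<close> a chi-squared variable with \<open>card J\<close> degrees
  of freedom; \<open>|P z|^2\<close> and \<open>|R z|^2\<close> take this form in a joint
  eigenbasis.\<close>

definition block_norm2 :: "'n set \<Rightarrow> real^'n \<Rightarrow> real" where
  "block_norm2 J x = (\<Sum>i\<in>J. (x $ i)\<^sup>2)"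

lemma block_norm2_nonneg: "0 \<le> block_norm2 J x"
  by (simp add: block_norm2_def sum_nonneg)

lemma block_norm2_measurable [measurable]: "block_norm2 J \<in> borel_measurable borel"
  unfolding block_norm2_def by measurable

lemma std_gauss_block_norm2:
  fixes J :: "'n::finite set"
  shows "integrable std_gauss (block_norm2 J)"
    and "(\<integral>x. block_norm2 J x \<partial>(std_gauss :: (real^'n) measure)) = card J"
proof -
  have m: "(\<integral>\<^sup>+x. ennreal ((x $ j)\<^sup>2) \<partial>(std_gauss :: (real^'n) measure)) = 1" for j
  proof -
    \<comment> \<open>Writes the square of one coordinate as a product over all coordinates, with
      factor 1 away from \<open>j\<close>.\<close>
    define f where "f i t = ennreal (if i = j then t\<^sup>2 else 1)" for i :: 'n and t :: real
    have [measurable]: "f i \<in> borel_measurable borel" for i unfolding f_def by measurable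
    have "(\<integral>\<^sup>+x. ennreal ((x $ j)\<^sup>2) \<partial>(std_gauss :: (real^'n) measure))
      = (\<integral>\<^sup>+x. (\<Prod>i\<in>UNIV. f i (x $ i)) \<partial>(std_gauss :: (real^'n) measure))"
      by (intro nn_integral_cong) (simp add: f_def prod_ennreal prod.delta)
    also have "\<dots> = (\<Prod>i\<in>UNIV. \<integral>\<^sup>+t. f i t * ennreal (std_normal_density t) \<partial>lborel)"
      by (rule nn_integral_std_gauss_prod) simp
    also have "\<dots> = (\<Prod>i\<in>(UNIV :: 'n set). 1)"
    proof (intro prod.cong refl)
      show "(\<integral>\<^sup>+t. f i t * ennreal (std_normal_density t) \<partial>lborel) = 1" for i
        using nn_integral_std_normal_even_moment[of 0] nn_integral_std_normal_even_moment[of 1]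
        by (cases "i = j") (simp_all add: f_def fact_2)
    qed
    finally show ?thesis by simp
  qed
  have nn: "(\<integral>\<^sup>+x. ennreal (block_norm2 J x) \<partial>(std_gauss :: (real^'n) measure)) = ennreal (card J)"
  proof -
    have "(\<integral>\<^sup>+x. ennreal (block_norm2 J x) \<partial>(std_gauss :: (real^'n) measure))
      = (\<integral>\<^sup>+x. (\<Sum>j\<in>J. ennreal ((x $ j)\<^sup>2)) \<partial>(std_gauss :: (real^'n) measure))"
      by (simp add: block_norm2_def)
    also have "\<dots> = (\<Sum>j\<in>J. \<integral>\<^sup>+x. ennreal ((x $ j)\<^sup>2) \<partial>(std_gauss :: (real^'n) measure))"
      by (rule nn_integral_sum) measurable
    finally show ?thesis by (simp add: m ennreal_of_nat_eq_real_of_nat)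
  qed
  show "integrable (std_gauss :: (real^'n) measure) (block_norm2 J)"
    by (rule integrableI_nonneg) (simp_all add: nn block_norm2_nonneg)
  show "(\<integral>x. block_norm2 J x \<partial>(std_gauss :: (real^'n) measure)) = card J"
    by (subst integral_eq_nn_integral) (simp_all add: nn block_norm2_nonneg)
qed

text \<open>The zero set lies in a coordinate hyperplane. This permits cancelling
  \<open>block_norm2 J\<close> almost everywhere.\<close>

lemma std_gauss_block_norm2_nonzero:
  fixes J :: "'n::finite set"
  assumes "J \<noteq> {}"
  shows "AE x in std_gauss. block_norm2 J (x :: real^'n) \<noteq> 0"
proof -
  obtain i where i: "i \<in> J" using assms by blast
  have "{x :: real^'n. x $ i = 0} \<in> sets lborel" by measurable
  then have "{x :: real^'n. x $ i = 0} \<in> null_sets lborel"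
    using negligible_standard_hyperplane_cart[of i]
    by (simp add: negligible_iff_null_sets null_sets_completion_iff)
  then have "AE x :: real^'n in lborel. x $ i \<noteq> 0"
    by (rule AE_I') auto
  then have "AE x :: real^'n in std_gauss. x $ i \<noteq> 0"
    unfolding std_gauss_def by (subst AE_density) auto
  then show ?thesis
  proof (rule AE_mp, intro AE_I2 impI)
    fix x :: "real^'n" assume "x $ i \<noteq> 0"
    then show "block_norm2 J x \<noteq> 0"
      unfolding block_norm2_def using i by (subst sum_nonneg_eq_0_iff) auto
  qed
qed

text \<open>Expanding the square leaves monomials \<open>x_j^2 x_k^2\<close>, which factorise. The
  moment is 3 for \<open>j = k\<close> and 1 otherwise, so the double sum is
  \<open>3 m + m (m - 1) = m (m + 2)\<close> with \<open>m = card J'\<close>; each coordinate in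
  \<open>J\<close> contributes \<open>(1 + 2 s) powr (- 1 / 2)\<close>.\<close>

lemma std_gauss_exp_block:
  fixes J J' :: "'n::finite set"
  assumes s: "0 \<le> s" and disj: "J \<inter> J' = {}"
  shows "(\<integral>\<^sup>+x. ennreal ((block_norm2 J' x)\<^sup>2 * exp (- s * block_norm2 J x)) \<partial>(std_gauss :: (real^'n) measure))
    = ennreal (card J' * (card J' + 2)) * ennreal ((1 + 2 * s) powr (- card J / 2))"
proof -
  let ?e = "ennreal ((1 + 2 * s) powr (- card J / 2))"
  have m: "(\<integral>\<^sup>+x. ennreal ((x $ j)\<^sup>2 * (x $ k)\<^sup>2 * exp (- s * block_norm2 J x)) \<partial>(std_gauss :: (real^'n) measure))
    = ennreal (if j = k then 3 else 1) * ?e" if jk: "j \<in> J'" "k \<in> J'" for j k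
  proof -
    \<comment> \<open>The exponent adds two indicators, so \<open>j = k\<close> produces a fourth
      power at a single coordinate, and coordinates outside \<open>J\<close> other than
      \<open>j\<close> and \<open>k\<close> get exponent 0.\<close>
    define f where "f i t = ennreal (if i \<in> J then exp (- s * t\<^sup>2)
      else t ^ (2 * (of_bool (i = j) + of_bool (i = k))))" for i :: 'n and t :: real
    have [measurable]: "f i \<in> borel_measurable borel" for i unfolding f_def by measurable
    have f_prod: "ennreal ((x $ j)\<^sup>2 * (x $ k)\<^sup>2 * exp (- s * block_norm2 J x)) = (\<Prod>i\<in>UNIV. f i (x $ i))" for x
    proof -
      have "(\<Prod>i\<in>UNIV. f i (x $ i)) = ennreal (\<Prod>i\<in>UNIV. if i \<in> J then exp (- s * (x $ i)\<^sup>2)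
          else (x $ i) ^ (2 * (of_bool (i = j) + of_bool (i = k))))"
        unfolding f_def
      proof (rule prod_ennreal)
        show "0 \<le> (if i \<in> J then exp (- s * (x $ i)\<^sup>2) else (x $ i) ^ (2 * (of_bool (i = j) + of_bool (i = k))))" for i
          by (cases "i \<in> J") (simp_all only: if_True if_False exp_ge_zero power_mult zero_le_power[OF zero_le_power2])
      qed
      also have "(\<Prod>i\<in>UNIV. if i \<in> J then exp (- s * (x $ i)\<^sup>2)
          else (x $ i) ^ (2 * (of_bool (i = j) + of_bool (i = k))))
        = (\<Prod>i\<in>UNIV. (if i \<in> J then exp (- s * (x $ i)\<^sup>2) else 1) *
            ((if i = j then (x $ i)\<^sup>2 else 1) * (if i = k then (x $ i)\<^sup>2 else 1)))"
        using disj jk by (intro prod.cong) (auto simp: power2_eq_square eval_nat_numeral)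
      also have "\<dots> = (\<Prod>i\<in>J. exp (- s * (x $ i)\<^sup>2)) * ((x $ j)\<^sup>2 * (x $ k)\<^sup>2)"
        by (simp only: prod.distrib) (simp add: prod.If_cases)
      also have "(\<Prod>i\<in>J. exp (- s * (x $ i)\<^sup>2)) = exp (- s * block_norm2 J x)"
        by (simp add: exp_sum[symmetric] block_norm2_def sum_distrib_left sum_negf)
      finally show ?thesis by (simp add: mult.commute)
    qed
    have f_int: "(\<integral>\<^sup>+t. f i t * ennreal (std_normal_density t) \<partial>lborel)
      = ennreal (if i \<in> J then (1 + 2 * s) powr (- 1 / 2) else if i = j \<and> j = k then 3 else 1)" for i
    proof (cases "i \<in> J")
      case True
      then show ?thesis using nn_integral_std_normal_exp[OF s] by (simp add: f_def)
    next
      case False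
      then have "(\<integral>\<^sup>+t. f i t * ennreal (std_normal_density t) \<partial>lborel)
        = (\<integral>\<^sup>+t. ennreal (t ^ (2 * (of_bool (i = j) + of_bool (i = k)))) * ennreal (std_normal_density t) \<partial>lborel)"
        by (simp add: f_def)
      also have "\<dots> = ennreal (if i = j \<and> j = k then 3 else 1)"
        unfolding nn_integral_std_normal_even_moment by (auto simp: fact_numeral)
      finally show ?thesis using False by simp
    qed
    have "(\<integral>\<^sup>+x. ennreal ((x $ j)\<^sup>2 * (x $ k)\<^sup>2 * exp (- s * block_norm2 J x)) \<partial>(std_gauss :: (real^'n) measure))
      = (\<Prod>i\<in>(UNIV :: 'n set). ennreal (if i \<in> J then (1 + 2 * s) powr (- 1 / 2) else if i = j \<and> j = k then 3 else 1))"
      unfolding f_prod by (subst nn_integral_std_gauss_prod) (simp_all add: f_int)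
    also have "\<dots> = ennreal (\<Prod>i\<in>(UNIV :: 'n set). (if i \<in> J then (1 + 2 * s) powr (- 1 / 2) else 1) * (if i = j then if j = k then 3 else 1 else 1))"
      using disj jk by (subst prod_ennreal) (auto intro!: arg_cong[where f=ennreal] prod.cong)
    also have "(\<Prod>i\<in>(UNIV :: 'n set). (if i \<in> J then (1 + 2 * s) powr (- 1 / 2) else 1) * (if i = j then if j = k then 3 else 1 else 1))
      = ((1 + 2 * s) powr (- 1 / 2)) ^ card J * (if j = k then 3 else 1 :: real)"
      by (simp only: prod.distrib) (simp add: prod.If_cases)
    also have "((1 + 2 * s) powr (- 1 / 2)) ^ card J = (1 + 2 * s) powr (- card J / 2)"
      using s by (simp add: powr_power)
    finally show ?thesis by (simp add: ennreal_mult' mult.commute)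
  qed
  define F where "F j k x = ennreal ((x $ j)\<^sup>2 * (x $ k)\<^sup>2 * exp (- s * block_norm2 J x))" for j k and x :: "real^'n"
  have [measurable]: "F j k \<in> borel_measurable borel" for j k unfolding F_def by measurable
  have "ennreal ((block_norm2 J' x)\<^sup>2 * exp (- s * block_norm2 J x)) = (\<Sum>j\<in>J'. \<Sum>k\<in>J'. F j k x)" for x
  proof -
    have "(block_norm2 J' x)\<^sup>2 = (\<Sum>j\<in>J'. \<Sum>k\<in>J'. (x $ j)\<^sup>2 * (x $ k)\<^sup>2)"
      unfolding block_norm2_def by (subst power2_eq_square) (rule sum_product)
    then show ?thesis by (simp add: F_def sum_ennreal sum_nonneg sum_distrib_right)
  qed
  then have "(\<integral>\<^sup>+x. ennreal ((block_norm2 J' x)\<^sup>2 * exp (- s * block_norm2 J x)) \<partial>(std_gauss :: (real^'n) measure))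
    = (\<integral>\<^sup>+x. (\<Sum>j\<in>J'. \<Sum>k\<in>J'. F j k x) \<partial>std_gauss)"
    by presburger
  also have "\<dots> = (\<Sum>j\<in>J'. \<integral>\<^sup>+x. (\<Sum>k\<in>J'. F j k x) \<partial>std_gauss)"
    by (rule nn_integral_sum) measurable
  also have "\<dots> = (\<Sum>j\<in>J'. \<Sum>k\<in>J'. \<integral>\<^sup>+x. F j k x \<partial>std_gauss)"
    by (intro sum.cong refl nn_integral_sum) measurable
  also have "\<dots> = (\<Sum>j\<in>J'. \<Sum>k\<in>J'. ennreal (if j = k then 3 else 1) * ?e)"
    unfolding F_def by (intro sum.cong refl m)
  also have "\<dots> = ennreal (\<Sum>j\<in>J'. \<Sum>k\<in>J'. if j = k then 3 else 1) * ?e"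
  proof -
    have "(\<Sum>k\<in>J'. ennreal (if j = k then 3 else 1)) = ennreal (\<Sum>k\<in>J'. if j = k then 3 else 1)" for j
      by (rule sum_ennreal) simp
    moreover have "(\<Sum>j\<in>J'. ennreal (\<Sum>k\<in>J'. if j = k then 3 else 1)) = ennreal (\<Sum>j\<in>J'. \<Sum>k\<in>J'. if j = k then 3 else 1)"
      by (rule sum_ennreal) (simp add: sum_nonneg)
    ultimately show ?thesis by (simp only: sum_distrib_right[symmetric])
  qed
  also have "(\<Sum>j\<in>J'. \<Sum>k\<in>J'. if j = k then 3 else (1::real)) = card J' * (card J' + 2)"
  proof -
    have "(\<Sum>k\<in>J'. if j = k then 3 else (1::real)) = card J' + 2" if "j \<in> J'" for j
    proof -
      have "(\<Sum>k\<in>J'. if j = k then 3 else (1::real)) = (\<Sum>k\<in>J'. 1 + (if j = k then 2 else 0))"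
        by (intro sum.cong) auto
      then show ?thesis using that by (simp add: sum.distrib)
    qed
    then show ?thesis by (simp add: algebra_simps)
  qed
  finally show ?thesis .
qed

text \<open>Tonelli moves the Laplace parameter outside, and integrating
  \<open>(1 + 2 s) powr (- card J / 2)\<close> over \<open>s\<close> yields the inverse moment of a
  chi-squared variable. The numerator splits off as a factor because the blocks are disjoint, hence
  independent.\<close>

lemma std_gauss_block_ratio:
  fixes J J' :: "'n::finite set"
  assumes J: "card J \<ge> 3" and disj: "J \<inter> J' = {}"
  shows "integrable std_gauss (\<lambda>x. (block_norm2 J' x)\<^sup>2 / block_norm2 J (x :: real^'n))"
    and "(\<integral>x. (block_norm2 J' x)\<^sup>2 / block_norm2 J x \<partial>(std_gauss :: (real^'n) measure))
      = card J' * (card J' + 2) / (card J - 2)"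
proof -
  interpret G: prob_space "std_gauss :: (real^'n) measure" by (rule prob_space_std_gauss)
  interpret P: pair_sigma_finite "std_gauss :: (real^'n) measure" "lborel :: real measure" ..
  let ?f = "\<lambda>x :: real^'n. (block_norm2 J' x)\<^sup>2 / block_norm2 J x"
  define c where "c = real (card J' * (card J' + 2))"
  have c: "0 \<le> c" by (simp add: c_def)
  have "(\<integral>\<^sup>+x. ennreal (?f x) \<partial>std_gauss)
    = (\<integral>\<^sup>+x. (\<integral>\<^sup>+s. ennreal ((block_norm2 J' x)\<^sup>2 * exp (- s * block_norm2 J x)) * indicator {0..} s \<partial>lborel) \<partial>std_gauss)"
  proof (rule nn_integral_cong_AE)
    have "J \<noteq> {}" using J by auto
    from std_gauss_block_norm2_nonzero[OF this]
    show "AE x in std_gauss. ennreal (?f x) =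
      (\<integral>\<^sup>+s. ennreal ((block_norm2 J' x)\<^sup>2 * exp (- s * block_norm2 J x)) * indicator {0..} s \<partial>lborel)"
    proof (rule AE_mp, intro AE_I2 impI)
      fix x :: "real^'n" assume "block_norm2 J x \<noteq> 0"
      then have pos: "0 < block_norm2 J x" using block_norm2_nonneg[of J x] by simp
      have "(\<integral>\<^sup>+s. ennreal ((block_norm2 J' x)\<^sup>2 * exp (- s * block_norm2 J x)) * indicator {0..} s \<partial>lborel)
        = ennreal ((block_norm2 J' x)\<^sup>2) * (\<integral>\<^sup>+s. ennreal (exp (- s * block_norm2 J x)) * indicator {0..} s \<partial>lborel)"
        by (subst nn_integral_cmult[symmetric]) (auto simp: ennreal_mult' mult.assoc)
      also have "\<dots> = ennreal (?f x)"
        unfolding nn_integral_exp_Laplace[OF pos] by (simp add: ennreal_mult'[symmetric])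
      finally show "ennreal (?f x) =
        (\<integral>\<^sup>+s. ennreal ((block_norm2 J' x)\<^sup>2 * exp (- s * block_norm2 J x)) * indicator {0..} s \<partial>lborel)" ..
    qed
  qed
  also have "\<dots> = (\<integral>\<^sup>+s. (\<integral>\<^sup>+x. ennreal ((block_norm2 J' x)\<^sup>2 * exp (- s * block_norm2 J x)) * indicator {0..} s \<partial>(std_gauss :: (real^'n) measure)) \<partial>lborel)"
    by (rule P.Fubini'[symmetric]) measurable
  also have "\<dots> = (\<integral>\<^sup>+s. ennreal c * (ennreal ((1 + 2 * s) powr (- card J / 2)) * indicator {0..} s) \<partial>lborel)"
  proof (intro nn_integral_cong)
    fix s :: real
    show "(\<integral>\<^sup>+x. ennreal ((block_norm2 J' x)\<^sup>2 * exp (- s * block_norm2 J x)) * indicator {0..} s \<partial>(std_gauss :: (real^'n) measure))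
      = ennreal c * (ennreal ((1 + 2 * s) powr (- card J / 2)) * indicator {0..} s)"
      using std_gauss_exp_block[OF _ disj, of s, folded c_def]
      by (cases "0 \<le> s") (simp_all add: nn_integral_multc mult.assoc)
  qed
  also have "\<dots> = ennreal c * ennreal (1 / (card J - 2))"
    using J nn_integral_powr_Laplace[of "real (card J)"] by (subst nn_integral_cmult) simp_all
  also have "\<dots> = ennreal (c / (card J - 2))"
    using c by (simp add: ennreal_mult'[symmetric])
  finally have nn: "(\<integral>\<^sup>+x. ennreal (?f x) \<partial>std_gauss) = ennreal (c / (card J - 2))" .
  show "integrable std_gauss ?f"
    by (rule integrableI_nonneg) (simp_all add: nn block_norm2_nonneg)
  show "(\<integral>x. ?f x \<partial>std_gauss) = card J' * (card J' + 2) / (card J - 2)"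
    using J by (subst integral_eq_nn_integral) (simp_all add: nn block_norm2_nonneg c c_def)
qed

lemma std_gauss_expectation_orthogonal:
  fixes F :: "real^'n \<Rightarrow> real" and T :: "real^'n \<Rightarrow> real^'n"
  assumes "orthogonal_transformation T" "F \<in> borel_measurable borel"
  shows "(\<integral>x. F (T x) \<partial>std_gauss) = (\<integral>x. F x \<partial>std_gauss)"
    and "integrable std_gauss (\<lambda>x. F (T x)) \<longleftrightarrow> integrable std_gauss F"
proof -
  have [measurable]: "T \<in> measurable std_gauss borel"
    using borel_measurable_orthogonal_transformation[OF assms(1)] by simp
  show "(\<integral>x. F (T x) \<partial>std_gauss) = (\<integral>x. F x \<partial>std_gauss)"
    using integral_distr[of T std_gauss borel F] assms(2) by (simp add: std_gauss_orthogonal[OF assms(1)])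
  show "integrable std_gauss (\<lambda>x. F (T x)) \<longleftrightarrow> integrable std_gauss F"
    using integrable_distr_eq[of T std_gauss borel F] assms(2) by (simp add: std_gauss_orthogonal[OF assms(1)])
qed

lemma orthogonal_transformation_coordinate_flip:
  "orthogonal_transformation (\<lambda>x :: real^'n. \<chi> k. if k = i then - x $ k else x $ k)"
  unfolding orthogonal_transformation_def
  by (auto intro!: linearI sum.cong simp: vec_eq_iff inner_vec_def)

lemma orthogonal_transformation_coordinate_swap:
  "orthogonal_transformation (\<lambda>x :: real^'n. \<chi> k. x $ Transposition.transpose i j k)"
proof -
  have bij: "bij (Transposition.transpose i j)" by simp
  have "(\<Sum>k\<in>UNIV. v $ Transposition.transpose i j k * w $ Transposition.transpose i j k) = (\<Sum>k\<in>UNIV. v $ k * w $ k)"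
    for v w :: "real^'n"
    using sum.reindex_bij_betw[OF bij, of "\<lambda>k. v $ k * w $ k"] by simp
  then show ?thesis
    unfolding orthogonal_transformation_def
    by (auto intro!: linearI simp: vec_eq_iff inner_vec_def)
qed

text \<open>Flipping one coordinate kills the mixed terms, and swapping two coordinates shows that the
  pure squares contribute equally.\<close>

lemma std_gauss_quadratic_form:
  fixes K :: "real^'n^'n" and J :: "'n set" and w :: "real^'n \<Rightarrow> real"
  assumes K: "\<And>i j. i \<notin> J \<or> j \<notin> J \<Longrightarrow> K $ i $ j = 0"
    and J: "J \<noteq> {}" and disj: "J \<inter> J' = {}"
    and w: "\<And>x. w x = f (block_norm2 J x) (block_norm2 J' x)"
    and [measurable]: "w \<in> borel_measurable borel"
    and int: "integrable std_gauss (\<lambda>x. w x * block_norm2 J x)"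
  shows "integrable std_gauss (\<lambda>x. w x * (x \<bullet> (K *v x)))"
    and "(\<integral>x. w x * (x \<bullet> (K *v x)) \<partial>std_gauss)
      = trace K / card J * (\<integral>x. w x * block_norm2 J x \<partial>std_gauss)"
proof -
  have quad: "w x * (x \<bullet> (K *v x)) = (\<Sum>i\<in>J. \<Sum>j\<in>J. K $ i $ j * (w x * (x $ i * x $ j)))" for x
  proof -
    have "x \<bullet> (K *v x) = (\<Sum>i\<in>UNIV. \<Sum>j\<in>UNIV. K $ i $ j * (x $ i * x $ j))"
      by (simp add: inner_vec_def matrix_vector_mult_def sum_distrib_left mult_ac)
    also have "\<dots> = (\<Sum>i\<in>J. \<Sum>j\<in>UNIV. K $ i $ j * (x $ i * x $ j))"
      using K by (intro sum.mono_neutral_right) auto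
    also have "\<dots> = (\<Sum>i\<in>J. \<Sum>j\<in>J. K $ i $ j * (x $ i * x $ j))"
      using K by (intro sum.cong refl sum.mono_neutral_right) auto
    finally show ?thesis by (simp add: sum_distrib_left mult_ac)
  qed
  have int_ij: "integrable std_gauss (\<lambda>x. w x * (x $ i * x $ j))" if "i \<in> J" "j \<in> J" for i j
  proof (rule Bochner_Integration.integrable_bound[OF int])
    show "AE x in std_gauss. norm (w x * (x $ i * x $ j)) \<le> norm (w x * block_norm2 J x)"
    proof (intro AE_I2)
      fix x :: "real^'n"
      have le: "(x $ k)\<^sup>2 \<le> block_norm2 J x" if "k \<in> J" for k
        unfolding block_norm2_def using that by (intro member_le_sum) auto
      have "\<bar>x $ i * x $ j\<bar> \<le> ((x $ i)\<^sup>2 + (x $ j)\<^sup>2) / 2"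
        using sum_squares_bound[of "\<bar>x $ i\<bar>" "\<bar>x $ j\<bar>"] by (simp add: abs_mult)
      also have "\<dots> \<le> block_norm2 J x" using le[OF \<open>i \<in> J\<close>] le[OF \<open>j \<in> J\<close>] by simp
      finally show "norm (w x * (x $ i * x $ j)) \<le> norm (w x * block_norm2 J x)"
        by (simp add: abs_mult mult_left_mono)
    qed
  qed measurable
  show "integrable std_gauss (\<lambda>x. w x * (x \<bullet> (K *v x)))"
    unfolding quad using int_ij by (intro Bochner_Integration.integrable_sum integrable_mult_right)
  define e where "e i j = (\<integral>x. w x * (x $ i * x $ j) \<partial>std_gauss)" for i j
  have e0: "e i j = 0" if "i \<in> J" "j \<in> J" "i \<noteq> j" for i j
  proof -
    define T where "T x = (\<chi> k. if k = i then - x $ k else x $ k)" for x :: "real^'n"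
    have bn: "block_norm2 I (T x) = block_norm2 I x" for I x
      unfolding block_norm2_def by (intro sum.cong) (auto simp: T_def)
    have T: "orthogonal_transformation T"
      unfolding T_def by (rule orthogonal_transformation_coordinate_flip)
    have "e i j = (\<integral>x. w (T x) * (T x $ i * T x $ j) \<partial>std_gauss)"
      unfolding e_def by (rule std_gauss_expectation_orthogonal(1)[OF T, symmetric]) measurable
    also have "\<dots> = (\<integral>x. - (w x * (x $ i * x $ j)) \<partial>std_gauss)"
      using that by (simp add: w bn) (simp add: T_def)
    finally show ?thesis by (simp add: e_def)
  qed
  have e_eq: "e i i = e j j" if "i \<in> J" "j \<in> J" for i j
  proof -
    define T where "T x = (\<chi> k. x $ Transposition.transpose i j k)" for x :: "real^'n"
    have T: "orthogonal_transformation T"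
      unfolding T_def by (rule orthogonal_transformation_coordinate_swap)
    have bn: "block_norm2 J (T x) = block_norm2 J x" for x
    proof -
      have "Transposition.transpose i j k \<in> J" if "k \<in> J" for k
        using that \<open>i \<in> J\<close> \<open>j \<in> J\<close> by (cases "k = i"; cases "k = j") simp_all
      then have "bij_betw (Transposition.transpose i j) J J"
        by (intro bij_betwI[where g = "Transposition.transpose i j"]) auto
      from sum.reindex_bij_betw[OF this, of "\<lambda>k. (x $ k)\<^sup>2"]
      show ?thesis by (simp add: block_norm2_def T_def)
    qed
    have bn': "block_norm2 J' (T x) = block_norm2 J' x" for x
    proof -
      have "Transposition.transpose i j k = k" if "k \<in> J'" for k
        using that \<open>i \<in> J\<close> \<open>j \<in> J\<close> disj by (intro transpose_apply_other) auto
      then show ?thesis by (simp add: block_norm2_def T_def)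
    qed
    have "e i i = (\<integral>x. w (T x) * (T x $ i * T x $ i) \<partial>std_gauss)"
      unfolding e_def by (rule std_gauss_expectation_orthogonal(1)[OF T, symmetric]) measurable
    also have "\<dots> = e j j"
      unfolding e_def by (simp add: w bn bn') (simp add: T_def)
    finally show ?thesis .
  qed
  obtain i0 where i0: "i0 \<in> J" using J by blast
  have "(\<integral>x. w x * block_norm2 J x \<partial>std_gauss) = (\<Sum>i\<in>J. e i i)"
    unfolding block_norm2_def e_def using int_ij
    by (simp add: sum_distrib_left power2_eq_square Bochner_Integration.integral_sum)
  also have "\<dots> = card J * e i0 i0" using e_eq[OF _ i0] by simp
  finally have E: "(\<integral>x. w x * block_norm2 J x \<partial>std_gauss) = card J * e i0 i0" .
  have "(\<integral>x. w x * (x \<bullet> (K *v x)) \<partial>std_gauss) = (\<Sum>i\<in>J. \<Sum>j\<in>J. K $ i $ j * e i j)"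
    unfolding quad e_def using int_ij
    by (subst Bochner_Integration.integral_sum Bochner_Integration.integrable_sum;
        (intro Bochner_Integration.integrable_sum integrable_mult_right)?; simp add: Bochner_Integration.integral_sum)
  also have "\<dots> = (\<Sum>i\<in>J. K $ i $ i * e i i)"
  proof (intro sum.cong refl)
    fix i assume i: "i \<in> J"
    have "(\<Sum>j\<in>J. K $ i $ j * e i j) = (\<Sum>j\<in>J. if j = i then K $ i $ i * e i i else 0)"
      using e0 i by (intro sum.cong) auto
    then show "(\<Sum>j\<in>J. K $ i $ j * e i j) = K $ i $ i * e i i" using i by simp
  qed
  also have "\<dots> = (\<Sum>i\<in>J. K $ i $ i) * e i0 i0"
    using e_eq[OF _ i0] by (simp add: sum_distrib_right)
  also have "(\<Sum>i\<in>J. K $ i $ i) = trace K"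
    unfolding trace_def using K by (intro sum.mono_neutral_left) auto
  finally show "(\<integral>x. w x * (x \<bullet> (K *v x)) \<partial>std_gauss)
      = trace K / card J * (\<integral>x. w x * block_norm2 J x \<partial>std_gauss)"
    using J by (simp add: E card_eq_0_iff)
qed

section \<open>Projections and the risk of shrinkage estimators\<close>

text \<open>The eigenvalues 1 and 2 of \<open>P + 2 R\<close> single out the ranges of \<open>P\<close> and \<open>R\<close>.\<close>

lemma orthogonal_projections_diagonalization:
  fixes P R :: "real^'n^'n"
  assumes P: "transpose P = P" "P ** P = P" and R: "transpose R = R" "R ** R = R" and PR: "P ** R = 0"
  obtains U :: "real^'n^'n" and J J' where "orthogonal_matrix U" "J \<inter> J' = {}"
    "P ** U = U ** diag_matrix (\<lambda>i. of_bool (i \<in> J))" "R ** U = U ** diag_matrix (\<lambda>i. of_bool (i \<in> J'))"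
proof -
  define T where "T = P + 2 *\<^sub>R R"
  have sym: "transpose T = T"
  proof -
    have "transpose T = transpose P + 2 *\<^sub>R transpose R"
      by (simp add: T_def transpose_def vec_eq_iff)
    then show ?thesis by (simp only: P R T_def)
  qed
  obtain U l where U: "orthogonal_matrix U" and e: "\<And>i. T *v column i U = l i *\<^sub>R column i U"
    using symmetric_matrix_eigenbasis[OF sym] by blast
  have "transpose (P ** R) = R ** P" by (simp add: matrix_transpose_mul P R)
  then have RP: "R ** P = 0" by (simp add: PR transpose_def zero_vec_def)
  define J J' where "J = {i. l i = 1}" and "J' = {i. l i = 2}"
  have T: "T *v x = P *v x + 2 *\<^sub>R (R *v x)" for x
    by (simp add: T_def matrix_vector_mult_add_rdistrib scaleR_matrix_vector_assoc)
  have PT: "P *v (T *v x) = P *v x" and RT: "R *v (T *v x) = 2 *\<^sub>R (R *v x)" for x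
    by (simp_all add: T matrix_vector_right_distrib matrix_vector_mult_scaleR matrix_vector_mul_assoc P R PR RP)
  \<comment> \<open>Comparing \<open>P T = P\<close> and \<open>R T = 2 R\<close> with the
    eigenvalue equation: \<open>P\<close> kills eigenvectors with \<open>l i \<noteq> 1\<close>, and
    \<open>R\<close> those with \<open>l i \<noteq> 2\<close>.\<close>
  have Pe: "(1 - l i) *\<^sub>R (P *v column i U) = 0" and Re: "(2 - l i) *\<^sub>R (R *v column i U) = 0" for i
    using PT[of "column i U"] RT[of "column i U"]
    by (simp_all add: e matrix_vector_mult_scaleR scaleR_left_diff_distrib)
  have "P *v column i U = of_bool (i \<in> J) *\<^sub>R column i U" for i
  proof (cases "i \<in> J")
    case True
    then have "R *v column i U = 0" using Re[of i] by (simp add: J_def)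
    then show ?thesis using e[of i] True by (simp add: T J_def)
  next
    case False
    then show ?thesis using Pe[of i] by (simp add: J_def)
  qed
  moreover have "R *v column i U = of_bool (i \<in> J') *\<^sub>R column i U" for i
  proof (cases "i \<in> J'")
    case True
    then have "P *v column i U = 0" using Pe[of i] by (simp add: J'_def)
    then show ?thesis using e[of i] True by (simp add: T J'_def)
  next
    case False
    then show ?thesis using Re[of i] by (simp add: J'_def)
  qed
  moreover have "J \<inter> J' = {}" by (auto simp: J_def J'_def)
  ultimately show ?thesis using that[of U J J'] U by (simp add: matrix_mult_eigencolumns)
qed

lemma diagonalized_projection_norm:
  fixes P U :: "real^'n^'n"
  assumes U: "orthogonal_matrix U" and PU: "P ** U = U ** diag_matrix (\<lambda>i. of_bool (i \<in> J))"
  shows "(P *v (U *v x)) \<bullet> (P *v (U *v x)) = block_norm2 J x"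
proof -
  have "P *v (U *v x) = U *v (diag_matrix (\<lambda>i. of_bool (i \<in> J)) *v x)"
    by (simp only: matrix_vector_mul_assoc PU)
  then have "(P *v (U *v x)) \<bullet> (P *v (U *v x))
    = (diag_matrix (\<lambda>i. of_bool (i \<in> J)) *v x) \<bullet> (diag_matrix (\<lambda>i. of_bool (i \<in> J)) *v x)"
    using orthogonal_matrix_orthogonal_transformation[OF U] by (simp add: orthogonal_transformation_def)
  also have "\<dots> = (\<Sum>i\<in>UNIV. if i \<in> J then (x $ i)\<^sup>2 else 0)"
    unfolding inner_vec_def by (intro sum.cong) (simp_all add: diag_matrix_vector power2_eq_square)
  also have "\<dots> = block_norm2 J x" by (simp add: block_norm2_def sum.If_cases)
  finally show ?thesis .
qed

lemma diagonalized_projection_trace: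
  fixes P U :: "real^'n^'n"
  assumes U: "orthogonal_matrix U" and PU: "P ** U = U ** diag_matrix (\<lambda>i. of_bool (i \<in> J))"
  shows "trace P = card J"
proof -
  have UU: "U ** transpose U = mat 1" "transpose U ** U = mat 1" using U by (simp_all add: orthogonal_matrix_def)
  have "trace P = trace ((P ** U) ** transpose U)"
    by (simp add: matrix_mul_assoc[symmetric] UU)
  also have "\<dots> = trace (transpose U ** (P ** U))" by (rule trace_mul_sym)
  also have "transpose U ** (P ** U) = diag_matrix (\<lambda>i. of_bool (i \<in> J))"
    unfolding PU by (simp add: matrix_mul_assoc UU)
  finally show ?thesis by (simp add: trace_def diag_matrix_def of_bool_def sum.If_cases)
qed

text \<open>In a joint eigenbasis, symmetry within the block \<open>J\<close> replaces the form of
  \<open>K\<close> by \<open>trace K / q\<close> times \<open>|P z|^2\<close>. Then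
  \<open>w |P z|^2\<close> expands into
  \<open>|P z|^2 - 2 c |R z|^2 + c^2 |R z|^4 / |P z|^2\<close>, three terms with known
  expectations.\<close>

lemma std_gauss_Stein_expectation:
  fixes P R K :: "real^'n^'n" and q m c :: real
  assumes P: "transpose P = P" "P ** P = P" and R: "transpose R = R" "R ** R = R" and PR: "P ** R = 0"
    and tr: "trace P = q" "trace R = m" and q: "q \<ge> 3" and K: "P ** K ** P = K"
  defines "w \<equiv> \<lambda>z. (1 - c * (((R *v z) \<bullet> (R *v z)) / ((P *v z) \<bullet> (P *v z))))\<^sup>2"
  shows "integrable std_gauss (\<lambda>z. w z * (z \<bullet> (K *v z)))"
    and "(\<integral>z. w z * (z \<bullet> (K *v z)) \<partial>std_gauss) = trace K / q * (q - 2 * c * m + c\<^sup>2 * m * (m + 2) / (q - 2))"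
proof -
  obtain U J J' where U: "orthogonal_matrix U" and disj: "J \<inter> J' = {}"
    and PU: "P ** U = U ** diag_matrix (\<lambda>i. of_bool (i \<in> J))" and RU: "R ** U = U ** diag_matrix (\<lambda>i. of_bool (i \<in> J'))"
    using orthogonal_projections_diagonalization[OF P R PR] by blast
  have UU: "U ** transpose U = mat 1" "transpose U ** U = mat 1" using U by (simp_all add: orthogonal_matrix_def)
  have q_card: "q = card J" and m_card: "m = card J'"
    using diagonalized_projection_trace[OF U PU] diagonalized_projection_trace[OF U RU] tr by simp_all
  have J: "card J \<ge> 3" "J \<noteq> {}" using q by (auto simp: q_card)
  define K' where "K' = transpose U ** K ** U"
  define w' where "w' x = (1 - c * (block_norm2 J' x / block_norm2 J x))\<^sup>2" for x :: "real^'n"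
  have wU: "w (U *v x) = w' x" for x
    by (simp add: w_def w'_def diagonalized_projection_norm[OF U PU] diagonalized_projection_norm[OF U RU])
  have KU: "(U *v x) \<bullet> (K *v (U *v x)) = x \<bullet> (K' *v x)" for x
  proof -
    have "(U *v x) \<bullet> (K *v (U *v x)) = x \<bullet> (transpose U *v (K *v (U *v x)))"
      by (rule inner_matrix_vector_transpose)
    also have "transpose U *v (K *v (U *v x)) = K' *v x"
      by (simp only: K'_def matrix_vector_mul_assoc matrix_mul_assoc)
    finally show ?thesis .
  qed
  have trK: "trace K' = trace K"
  proof -
    have "trace K' = trace (U ** (transpose U ** K))" unfolding K'_def by (rule trace_mul_sym)
    then show ?thesis by (simp add: matrix_mul_assoc UU)
  qed
  \<comment> \<open>\<open>P K P = K\<close> confines the rotated matrix to the block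
    \<open>J\<close>, as the quadratic form lemma demands.\<close>
  have K'_eq: "K' = diag_matrix (\<lambda>i. of_bool (i \<in> J)) ** (K' ** diag_matrix (\<lambda>i. of_bool (i \<in> J)))"
  proof -
    let ?D = "diag_matrix (\<lambda>i. of_bool (i \<in> J)) :: real^'n^'n"
    have "transpose (P ** U) = transpose (U ** ?D)" by (simp only: PU)
    then have UP: "transpose U ** P = ?D ** transpose U"
      by (simp add: matrix_transpose_mul P transpose_diag_matrix)
    have "K' = (transpose U ** P) ** K ** (P ** U)"
      unfolding K'_def by (subst K[symmetric]) (simp only: matrix_mul_assoc)
    also have "\<dots> = ?D ** (K' ** ?D)"
      unfolding UP PU K'_def by (simp only: matrix_mul_assoc)
    finally show ?thesis .
  qed
  have K'0: "K' $ i $ j = 0" if "i \<notin> J \<or> j \<notin> J" for i j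
  proof -
    have "K' $ i $ j = of_bool (i \<in> J) * (K' $ i $ j * of_bool (j \<in> J))"
      by (subst K'_eq) (simp add: matrix_matrix_mult_def diag_matrix_def
        if_distrib[of "\<lambda>c. _ * c"] if_distrib[of "\<lambda>c. c * _"] sum.delta sum.delta' cong: if_cong)
    then show ?thesis using that by auto
  qed
  have wm [measurable]: "w' \<in> borel_measurable borel" unfolding w'_def by measurable
  note n1 = std_gauss_block_norm2[of J] and n2 = std_gauss_block_norm2[of J']
    and n3 = std_gauss_block_ratio[OF J(1) disj]
  \<comment> \<open>The expanded product. The identity may fail where \<open>block_norm2 J\<close>
    is 0, since division by 0 yields 0, so it is claimed almost everywhere.\<close>
  let ?g = "\<lambda>x. block_norm2 J x - 2 * c * block_norm2 J' x + c\<^sup>2 * ((block_norm2 J' x)\<^sup>2 / block_norm2 J x)"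
  have AE: "AE x in std_gauss. ?g x = w' x * block_norm2 J x"
    using std_gauss_block_norm2_nonzero[OF J(2)]
    by (rule AE_mp) (auto simp: w'_def field_simps power2_eq_square intro!: AE_I2)
  have int_g: "integrable std_gauss ?g"
    using n1(1) n2(1) n3(1) by (intro Bochner_Integration.integrable_add Bochner_Integration.integrable_diff integrable_mult_right)
  have wm': "(\<lambda>x. w' x * block_norm2 J x) \<in> borel_measurable std_gauss" by measurable
  have int_w: "integrable std_gauss (\<lambda>x. w' x * block_norm2 J x)"
    by (rule integrable_cong_AE_imp[OF int_g wm' AE])
  have "(\<integral>x. w' x * block_norm2 J x \<partial>std_gauss) = (\<integral>x. ?g x \<partial>std_gauss)"
    by (rule integral_cong_AE[OF borel_measurable_integrable[OF int_g] wm' AE, symmetric])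
  also have "\<dots> = q - 2 * c * m + c\<^sup>2 * (m * (m + 2) / (q - 2))"
  proof -
    have "(\<integral>x. ?g x \<partial>std_gauss) = (\<integral>x. block_norm2 J x \<partial>std_gauss) - (\<integral>x. 2 * c * block_norm2 J' x \<partial>std_gauss)
        + (\<integral>x. c\<^sup>2 * ((block_norm2 J' x)\<^sup>2 / block_norm2 J x) \<partial>std_gauss)"
      using n1(1) n2(1) n3(1)
      by (subst Bochner_Integration.integral_add Bochner_Integration.integral_diff;
          (intro Bochner_Integration.integrable_diff integrable_mult_right)?;
          simp add: Bochner_Integration.integral_diff)
    then show ?thesis
      by (simp only: integral_mult_right_zero n1(2) n2(2) n3(2))
        (use J(1) in \<open>simp add: q_card m_card of_nat_diff algebra_simps\<close>)
  qed
  finally have E: "(\<integral>x. w' x * block_norm2 J x \<partial>std_gauss) = q - 2 * c * m + c\<^sup>2 * m * (m + 2) / (q - 2)"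
    by simp
  note QF = std_gauss_quadratic_form[of J K' J' w' "\<lambda>a b. (1 - c * (b / a))\<^sup>2", OF K'0 J(2) disj w'_def wm int_w]
  note T = std_gauss_expectation_orthogonal[OF orthogonal_matrix_orthogonal_transformation[OF U], of "\<lambda>z. w z * (z \<bullet> (K *v z))"]
  have m: "(\<lambda>z. w z * (z \<bullet> (K *v z))) \<in> borel_measurable borel" unfolding w_def by measurable
  show "integrable std_gauss (\<lambda>z. w z * (z \<bullet> (K *v z)))"
    using T(2)[OF m] QF(1) by (simp add: wU KU)
  show "(\<integral>z. w z * (z \<bullet> (K *v z)) \<partial>std_gauss) = trace K / q * (q - 2 * c * m + c\<^sup>2 * m * (m + 2) / (q - 2))"
    using T(1)[OF m] QF(2) by (simp add: wU KU trK E q_card)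
qed

text \<open>Both maps are bounded, so the product is dominated by a multiple of
  \<open>|z|^2\<close>.\<close>

lemma integrable_std_gauss_bilinear:
  fixes A B :: "real^'n^'p"
  shows "integrable std_gauss (\<lambda>z. (A *v z) \<bullet> (B *v z))"
proof -
  obtain a where a: "\<And>z. norm (A *v z) \<le> norm z * a"
    using bounded_linear.bounded[OF matrix_vector_mul_bounded_linear[of A]] by blast
  obtain b where b: "\<And>z. norm (B *v z) \<le> norm z * b"
    using bounded_linear.bounded[OF matrix_vector_mul_bounded_linear[of B]] by blast
  have n: "norm z * norm z = block_norm2 UNIV z" for z :: "real^'n"
    by (simp add: block_norm2_def norm_eq_sqrt_inner inner_vec_def power2_eq_square sum_nonneg)
  show ?thesis
  proof (rule Bochner_Integration.integrable_bound[of _ "\<lambda>z. (a * b) * block_norm2 UNIV z"])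
    show "integrable std_gauss (\<lambda>z. (a * b) * block_norm2 UNIV (z :: real^'n))"
      using std_gauss_block_norm2(1)[of "UNIV :: 'n set"] by (rule integrable_mult_right)
    show "AE z in std_gauss. norm ((A *v z) \<bullet> (B *v z)) \<le> norm ((a * b) * block_norm2 UNIV z)"
    proof (intro AE_I2)
      fix z :: "real^'n"
      have "norm ((A *v z) \<bullet> (B *v z)) \<le> norm (A *v z) * norm (B *v z)"
        by (simp add: Cauchy_Schwarz_ineq2)
      also have "\<dots> \<le> (norm z * a) * (norm z * b)"
        by (rule mult_mono[OF a b]) (use a[of z] norm_ge_zero[of "A *v z"] in linarith, simp)
      also have "\<dots> = (a * b) * block_norm2 UNIV z" by (simp add: n[symmetric])
      finally show "norm ((A *v z) \<bullet> (B *v z)) \<le> norm ((a * b) * block_norm2 UNIV z)" by simp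
    qed
  qed measurable
qed

lemma pos_def_quadratic_form_nonneg: "pos_def W \<Longrightarrow> 0 \<le> u \<bullet> (W *v u)"
  by (cases "u = 0") (simp_all add: pos_def_def less_imp_le)

text \<open>The reflection \<open>z - 2 P z\<close> preserves the Gaussian measure and reverses the sign of the
  cross term.\<close>

lemma std_gauss_shrinkage_loss:
  fixes P :: "real^'n^'n" and W :: "real^'p^'p" and A B :: "real^'n^'p" and a :: "real^'n \<Rightarrow> real"
  assumes P: "transpose P = P" "P ** P = P" and W: "pos_def W"
    and A: "A ** P = 0" and B: "B ** P = B"
    and [measurable]: "a \<in> borel_measurable borel"
    and a: "\<And>z. a (z - 2 *\<^sub>R (P *v z)) = a z"
    and int: "integrable std_gauss (\<lambda>z. (a z)\<^sup>2 * ((B *v z) \<bullet> (W *v (B *v z))))"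
  defines "loss \<equiv> \<lambda>z. (A *v z + a z *\<^sub>R (B *v z)) \<bullet> (W *v (A *v z + a z *\<^sub>R (B *v z)))"
  shows "integrable std_gauss loss"
    and "(\<integral>z. loss z \<partial>std_gauss) = (\<integral>z. (A *v z) \<bullet> (W *v (A *v z)) \<partial>std_gauss)
      + (\<integral>z. (a z)\<^sup>2 * ((B *v z) \<bullet> (W *v (B *v z))) \<partial>std_gauss)"
proof -
  let ?QA = "\<lambda>z. (A *v z) \<bullet> (W *v (A *v z))" and ?QB = "\<lambda>z. (a z)\<^sup>2 * ((B *v z) \<bullet> (W *v (B *v z)))"
  have int_A: "integrable std_gauss ?QA"
    using integrable_std_gauss_bilinear[of A "W ** A"] by (simp add: matrix_vector_mul_assoc)
  have Wsym: "u \<bullet> (W *v v) = v \<bullet> (W *v u)" for u v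
    using symmetric_inner_swap[OF pos_def_transpose[OF W], of u v] by (simp add: inner_commute)
  define cross where "cross z = 2 * a z * ((A *v z) \<bullet> (W *v (B *v z)))" for z
  have loss_eq: "loss z = ?QA z + cross z + ?QB z" for z
    using Wsym[of "B *v z" "A *v z"]
    by (simp add: loss_def cross_def matrix_vector_right_distrib matrix_vector_mult_scaleR inner_add_left
        inner_add_right power2_eq_square algebra_simps)
  \<comment> \<open>Nonnegativity of the form at \<open>A z - a(z) B z\<close> bounds the cross term
    by the two squares. Integrability of the loss follows without any separate bound on
    \<open>a\<close>, and that of the cross term by subtraction.\<close>
  have loss_le: "norm (loss z) \<le> norm (2 * ?QA z + 2 * ?QB z)" for z
  proof -
    have "0 \<le> (A *v z - a z *\<^sub>R (B *v z)) \<bullet> (W *v (A *v z - a z *\<^sub>R (B *v z)))"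
      by (rule pos_def_quadratic_form_nonneg[OF W])
    also have "\<dots> = ?QA z - cross z + ?QB z"
      using Wsym[of "B *v z" "A *v z"]
      by (simp add: cross_def matrix_vector_mult_diff_distrib matrix_vector_mult_scaleR inner_diff_left
          inner_diff_right power2_eq_square algebra_simps)
    finally have "loss z \<le> 2 * ?QA z + 2 * ?QB z" by (simp add: loss_eq)
    moreover have "0 \<le> loss z" unfolding loss_def by (rule pos_def_quadratic_form_nonneg[OF W])
    ultimately show ?thesis by simp
  qed
  show int_loss: "integrable std_gauss loss"
  proof (rule Bochner_Integration.integrable_bound)
    show "integrable std_gauss (\<lambda>z. 2 * ?QA z + 2 * ?QB z)"
      using int_A int by (intro Bochner_Integration.integrable_add integrable_mult_right)
    show "loss \<in> borel_measurable std_gauss" unfolding loss_def by measurable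
    show "AE z in std_gauss. norm (loss z) \<le> norm (2 * ?QA z + 2 * ?QB z)"
      by (rule AE_I2) (rule loss_le)
  qed
  have cross_loss: "cross = (\<lambda>z. loss z - ?QA z - ?QB z)" by (simp add: loss_eq fun_eq_iff)
  have int_cross: "integrable std_gauss cross"
    unfolding cross_loss using int_loss int_A int by (intro Bochner_Integration.integrable_diff)
  define T where "T z = z - 2 *\<^sub>R (P *v z)" for z
  have PT: "P *v (P *v z) = P *v z" and AT: "A *v (P *v z) = 0" and BT: "B *v (P *v z) = B *v z" for z
    by (simp_all add: matrix_vector_mul_assoc P A B)
  have "orthogonal_transformation T"
    unfolding orthogonal_transformation_def
  proof (intro conjI allI)
    show "linear T"
      unfolding T_def by (intro linearI) (simp_all add: matrix_vector_right_distrib matrix_vector_mult_scaleR algebra_simps)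
    fix v w
    have "(P *v v) \<bullet> (P *v w) = (P *v v) \<bullet> w" "v \<bullet> (P *v w) = (P *v v) \<bullet> w"
      using symmetric_inner_swap[OF P(1), of "P *v v" w] symmetric_inner_swap[OF P(1), of v w] by (simp_all add: PT)
    then show "T v \<bullet> T w = v \<bullet> w"
      by (simp add: T_def inner_diff_left inner_diff_right algebra_simps)
  qed
  moreover have "cross (T z) = - cross z" for z
  proof -
    have "A *v T z = A *v z - 2 *\<^sub>R 0" "B *v T z = B *v z - 2 *\<^sub>R (B *v z)"
      by (simp_all only: T_def matrix_vector_mult_diff_distrib matrix_vector_mult_scaleR AT BT)
    then have "A *v T z = A *v z" "B *v T z = - (B *v z)" by (simp_all add: scaleR_2)
    moreover have "W *v (- u) = - (W *v u)" for u
      using matrix_vector_mult_scaleR[of W "-1" u] by simp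
    moreover have "a (T z) = a z" unfolding T_def by (rule a)
    ultimately show ?thesis by (simp add: cross_def)
  qed
  ultimately have "(\<integral>z. - cross z \<partial>std_gauss) = (\<integral>z. cross z \<partial>std_gauss)"
    using std_gauss_expectation_orthogonal(1)[of T cross] int_cross by (simp add: borel_measurable_integrable)
  then have "(\<integral>z. cross z \<partial>std_gauss) = 0" by simp
  moreover have "(\<integral>z. loss z \<partial>std_gauss) = (\<integral>z. ?QA z + cross z + ?QB z \<partial>std_gauss)" by (simp only: loss_eq)
  ultimately show "(\<integral>z. loss z \<partial>std_gauss) = (\<integral>z. ?QA z \<partial>std_gauss) + (\<integral>z. ?QB z \<partial>std_gauss)"
    using int_A int_cross int by (simp add: Bochner_Integration.integral_add)
qed

section \<open>Algebra of generalised least squares\<close>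

lemma pos_def_matrix_inv:
  assumes "pos_def A"
  shows "pos_def (matrix_inv A)"
  unfolding pos_def_def
proof (intro conjI allI impI)
  note inv = pos_def_invertible[OF assms]
  show "transpose (matrix_inv A) = matrix_inv A"
    by (rule transpose_matrix_inv_sym[OF inv pos_def_transpose[OF assms]])
  fix x :: "real^'a" assume "x \<noteq> 0"
  define u where "u = matrix_inv A *v x"
  have x: "A *v u = x" by (simp add: u_def matrix_vector_mul_assoc matrix_inv_right[OF inv])
  have "u \<noteq> 0" using x \<open>x \<noteq> 0\<close> by auto
  then have "0 < u \<bullet> (A *v u)" using assms by (simp add: pos_def_def)
  then show "0 < x \<bullet> (matrix_inv A *v x)" by (simp add: x u_def[symmetric] inner_commute)
qed

lemma pos_def_congruence:
  fixes A :: "real^'n^'n" and B :: "real^'p^'n"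
  assumes A: "pos_def A" and B: "inj ((*v) B)"
  shows "pos_def (transpose B ** A ** B)"
  unfolding pos_def_def
proof (intro conjI allI impI)
  show "transpose (transpose B ** A ** B) = transpose B ** A ** B"
    by (simp add: matrix_transpose_mul pos_def_transpose[OF A] matrix_mul_assoc)
  fix x :: "real^'p" assume "x \<noteq> 0"
  then have "B *v x \<noteq> 0" using B by (metis injD matrix_vector_mult_0_right)
  then have "0 < (B *v x) \<bullet> (A *v (B *v x))" using A by (simp add: pos_def_def)
  also have "\<dots> = x \<bullet> (transpose B *v (A *v (B *v x)))"
    by (rule inner_matrix_vector_transpose)
  also have "transpose B *v (A *v (B *v x)) = (transpose B ** A ** B) *v x"
    by (simp only: matrix_vector_mul_assoc matrix_mul_assoc)
  finally show "0 < x \<bullet> ((transpose B ** A ** B) *v x)" .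
qed

text \<open>Replaces the trace of a \<open>q\<close> by \<open>q\<close> block by the trace of a
  product of \<open>p\<close> by \<open>p\<close> matrices, to which cyclicity applies.\<close>

lemma trace_leading_block:
  fixes A :: "real^'p^'p" and ix :: "'q::finite \<Rightarrow> 'p"
  assumes "inj ix"
  shows "trace (leading_block ix A) = trace (block_identity ix ** A)"
proof -
  have "trace (block_identity ix ** A) = (\<Sum>i\<in>UNIV. if i \<in> range ix then A $ i $ i else 0)"
    unfolding trace_def
  proof (intro sum.cong refl)
    show "(block_identity ix ** A) $ i $ i = (if i \<in> range ix then A $ i $ i else 0)" for i
      by (cases "i \<in> range ix")
        (simp_all add: block_identity_def matrix_matrix_mult_def if_distrib[of "\<lambda>c. c * _"] cong: if_cong)
  qed
  also have "\<dots> = (\<Sum>i\<in>range ix. A $ i $ i)" by (simp add: sum.If_cases)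
  also have "\<dots> = trace (leading_block ix A)"
    using assms by (simp add: sum.reindex trace_def leading_block_def)
  finally show ?thesis ..
qed

lemma complementary_projection:
  fixes P :: "real^'n^'n"
  assumes "transpose P = P" "P ** P = P"
  shows "transpose (mat 1 - P) = mat 1 - P" "(mat 1 - P) ** (mat 1 - P) = mat 1 - P"
proof -
  have "transpose (mat 1 - P) = mat 1 - transpose P"
    by (simp add: transpose_def vec_eq_iff mat_def eq_commute)
  then show "transpose (mat 1 - P) = mat 1 - P" by (simp only: assms)
  show "(mat 1 - P) ** (mat 1 - P) = mat 1 - P"
    by (simp add: matrix_sub_ldistrib matrix_sub_rdistrib assms)
qed

text \<open>\<open>N\<close> is the whitened design and \<open>S\<close> stands for
  \<open>H' V1 H\<close>. Then \<open>N G\<close> is the orthogonal projection onto the column space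
  of \<open>N\<close>, \<open>R\<close> projects onto the residuals, and \<open>P\<close> onto the
  part of the column space that the restriction sees. \<open>B z\<close> will be the difference of
  the unrestricted and the restricted estimator, \<open>(G - B) z\<close> the error of the latter
  under \<open>H0\<close>.\<close>

lemma gls_projections:
  fixes N :: "real^'p^'n" and C S :: "real^'p^'p"
  assumes NN: "transpose N ** N = C" and inv: "invertible C"
    and S: "transpose S = S" and SCS: "S ** (matrix_inv C ** S) = S"
  defines "G \<equiv> matrix_inv C ** transpose N"
  defines "B \<equiv> matrix_inv C ** (S ** G)"
  defines "P \<equiv> transpose G ** (S ** G)" and "R \<equiv> mat 1 - N ** G"
  shows "transpose P = P" "P ** P = P" "transpose R = R" "R ** R = R" "P ** R = 0"
    "(G - B) ** P = 0" "B ** P = B" "trace P = trace (matrix_inv C ** S)"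
    "trace R = real CARD('n) - real CARD('p)" "B ** transpose B = matrix_inv C ** (S ** matrix_inv C)"
proof -
  define D where "D = matrix_inv C"
  have C: "transpose C = C" by (simp add: NN[symmetric] matrix_transpose_mul)
  have D: "transpose D = D" unfolding D_def by (rule transpose_matrix_inv_sym[OF inv C])
  have DC: "D ** C = mat 1" and CD: "C ** D = mat 1"
    by (simp_all add: D_def matrix_inv_left[OF inv] matrix_inv_right[OF inv])
  have tG: "transpose G = N ** D" by (simp add: G_def matrix_transpose_mul D[unfolded D_def] D_def)
  note SDS = SCS[folded D_def]
  note assoc = matrix_mul_assoc[symmetric]
  \<comment> \<open>With products nested to the right, a collapsing pair may be followed by further
    factors; the reassociated variants let rewriting reach it there too.\<close>
  note rules = assoc NN DC CD SDS matrix_mul_lid matrix_mul_rid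
    matrix_mul_assoc[of "transpose N" N, unfolded NN]
    matrix_mul_assoc[of D C, unfolded DC matrix_mul_lid]
    matrix_mul_assoc[of C D, unfolded CD matrix_mul_lid]
    matrix_mul_assoc[of S "D ** S", unfolded SDS, unfolded assoc]
  have G: "G = D ** transpose N" by (simp add: G_def D_def)
  have P: "P = N ** (D ** (S ** (D ** transpose N)))" unfolding P_def tG unfolding G by (simp only: assoc)
  have B: "B = D ** (S ** (D ** transpose N))" unfolding B_def G D_def[symmetric] ..
  show tP: "transpose P = P" unfolding P by (simp only: matrix_transpose_mul transpose_transpose D S assoc)
  show "P ** P = P" unfolding P by (simp only: rules)
  have NG: "transpose (N ** G) = N ** G" "(N ** G) ** (N ** G) = N ** G"
    unfolding G by (simp_all only: matrix_transpose_mul transpose_transpose D rules)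
  show "transpose R = R" "R ** R = R" unfolding R_def by (rule complementary_projection[OF NG])+
  have "P ** (N ** G) = P" unfolding P G by (simp only: rules)
  then show "P ** R = 0" by (simp add: R_def matrix_sub_ldistrib)
  have "G ** P = B" "B ** P = B" unfolding P G B by (simp_all only: rules)
  then show "(G - B) ** P = 0" "B ** P = B" by (simp_all add: matrix_sub_rdistrib)
  have "trace P = trace ((D ** (S ** (D ** transpose N))) ** N)" unfolding P by (rule trace_mul_sym)
  then show "trace P = trace (matrix_inv C ** S)" by (simp only: rules D_def[symmetric])
  have "trace (N ** G) = trace (G ** N)" by (rule trace_mul_sym)
  also have "G ** N = mat 1" unfolding G by (simp only: rules)
  finally show "trace R = real CARD('n) - real CARD('p)"
    by (simp add: R_def trace_sub trace_I)
  show "B ** transpose B = matrix_inv C ** (S ** matrix_inv C)"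
    unfolding B D_def[symmetric] by (simp only: matrix_transpose_mul transpose_transpose D S rules)
qed

theorem mainTheorem8:
  fixes M :: "'w measure" and eps y :: "'w \<Rightarrow> real^'n"
    and X :: "real^'p^'n" and V :: "real^'n^'n"
    and H :: "real^'p^'q" and h :: "real^'q"
    and W Q A :: "real^'p^'p" and ix :: "'q \<Rightarrow> 'p"
    and Wp Wm :: "real measure" and g :: "real \<Rightarrow> real"
    and \<beta> :: "real^'p" and \<sigma> sigma_eps_sq m d :: real
  assumes "CARD('p) < CARD('n)" and "CARD('q) < CARD('p)" and "CARD('q) \<ge> 3"
    and "rank X = CARD('p)" and "rank H = CARD('q)"
    and "pos_def V" and "pos_def W" and "\<sigma> > 0"
    and "mixing_measure Wp Wm"
    and "prob_space M"
    and "elliptical M eps 0 (\<sigma>\<^sup>2 *\<^sub>R V) g"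
    and "normal_mixture Wp Wm (\<sigma>\<^sup>2 *\<^sub>R V) g"
    and "\<And>\<omega>. \<omega> \<in> space M \<Longrightarrow> y \<omega> = X *v \<beta> + eps \<omega>"
    and "sigma_eps_sq = \<sigma>\<^sup>2 * signed_integral Wp Wm (\<lambda>t. 1 / t)"
    and "m = real CARD('n) - real CARD('p)"
    and "d = (real CARD('q) - 2) * m / (real CARD('q) * (m + 2))"
    and "inj ix" and "orthogonal_matrix Q"
    and "Q ** matrix_inv_sqrt (gram X V) ** transpose H ** V1 X V H ** H
           ** matrix_inv_sqrt (gram X V) ** transpose Q = block_identity ix"
    and "A = Q ** matrix_inv_sqrt (gram X V) ** W ** matrix_inv_sqrt (gram X V) ** transpose Q"
    and H0: "H *v \<beta> = h"
  shows "finite_risk M W (\<lambda>\<omega>. restricted_est X V H h (y \<omega>)) \<beta> \<and>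
    finite_risk M W (\<lambda>\<omega>. stein_est d X V H h (y \<omega>)) \<beta> \<and>
    finite_risk M W (\<lambda>\<omega>. pos_stein_est d X V H h (y \<omega>)) \<beta> \<and>
    risk M W (\<lambda>\<omega>. stein_est d X V H h (y \<omega>)) \<beta> =
      risk M W (\<lambda>\<omega>. restricted_est X V H h (y \<omega>)) \<beta>
      + sigma_eps_sq * (1 - d) * trace (leading_block ix A) \<and>
    risk M W (\<lambda>\<omega>. restricted_est X V H h (y \<omega>)) \<beta>
      + sigma_eps_sq * (1 - d) * trace (leading_block ix A)
      \<ge> risk M W (\<lambda>\<omega>. restricted_est X V H h (y \<omega>)) \<beta> \<and>
    risk M W (\<lambda>\<omega>. pos_stein_est d X V H h (y \<omega>)) \<beta>
      \<ge> risk M W (\<lambda>\<omega>. restricted_est X V H h (y \<omega>)) \<beta>"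
proof -
  define q where "q = real CARD('q)"
  note mixing = \<open>mixing_measure Wp Wm\<close> and V = \<open>pos_def V\<close> and W = \<open>pos_def W\<close> and sigma = \<open>\<sigma> > 0\<close>
    and y = \<open>\<And>\<omega>. \<omega> \<in> space M \<Longrightarrow> y \<omega> = X *v \<beta> + eps \<omega>\<close>
    and m = \<open>m = real CARD('n) - real CARD('p)\<close> and d = \<open>d = (real CARD('q) - 2) * m / (real CARD('q) * (m + 2))\<close>
    and sigma_eps = \<open>sigma_eps_sq = \<sigma>\<^sup>2 * signed_integral Wp Wm (\<lambda>t. 1 / t)\<close>
  have q: "q \<ge> 3" and m_pos: "m > 0" using \<open>CARD('q) \<ge> 3\<close> \<open>CARD('p) < CARD('n)\<close> by (simp_all add: q_def m)
  \<comment> \<open>The statistic carries the factors \<open>1 / q\<close> and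
    \<open>m / nR z\<close>, so its inverse times \<open>d\<close> is \<open>d q / m = c\<close>
    times \<open>nR z / nP z\<close>.\<close>
  define c where "c = (q - 2) / (m + 2)"
  have c_d: "d * q / m = c"
  proof -
    have "m + 2 > 0" using m_pos by simp
    then show ?thesis using q m_pos unfolding d c_def q_def[symmetric] by (simp add: divide_simps)
  qed

  \<comment> \<open>Whitening the model\<close>
  define L where "L = matrix_sqrt V"
  have L: "pos_def L" and LL: "L ** L = V" unfolding L_def by (rule matrix_sqrt_pos_def[OF V])+
  define Li where "Li = matrix_inv L"
  have Li_L: "Li ** L = mat 1" and L_Li: "L ** Li = mat 1" and tLi: "transpose Li = Li"
    unfolding Li_def using pos_def_invertible[OF L] pos_def_transpose[OF L]
    by (simp_all only: matrix_inv_left matrix_inv_right transpose_matrix_inv_sym)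
  have Vi: "matrix_inv V = Li ** Li"
    unfolding Li_def using matrix_inv_square[OF pos_def_invertible[OF L]] by (simp only: LL)
  define C where "C = gram X V"
  \<comment> \<open>The whitened design: its Gram matrix is \<open>C\<close>, so generalised least
    squares becomes ordinary least squares.\<close>
  define N where "N = Li ** X"
  have "inj ((*v) X)" using \<open>rank X = CARD('p)\<close> by (simp add: full_rank_injective)
  then have C: "pos_def C"
    unfolding C_def gram_def by (rule pos_def_congruence[OF pos_def_matrix_inv[OF V]])
  have NN: "transpose N ** N = C"
    unfolding N_def C_def gram_def by (simp only: Vi matrix_transpose_mul tLi matrix_mul_assoc)
  define Ci where "Ci = matrix_inv C"
  have Ci: "pos_def Ci" unfolding Ci_def by (rule pos_def_matrix_inv[OF C])
  define E where "E = H ** Ci ** transpose H"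
  have "rank (transpose H) = CARD('q)" using \<open>rank H = CARD('q)\<close> by (simp only: rank_transpose)
  then have "inj ((*v) (transpose H))" by (simp add: full_rank_injective)
  from pos_def_congruence[OF Ci this] have E: "pos_def E" by (simp add: E_def)
  define Ei where "Ei = matrix_inv E"
  have V1: "V1 X V H = Ei" by (simp only: V1_def Ei_def E_def Ci_def C_def)
  have tEi: "transpose Ei = Ei" unfolding Ei_def by (rule pos_def_transpose[OF pos_def_matrix_inv[OF E]])
  have Ei_E: "Ei ** E = mat 1" unfolding Ei_def by (rule matrix_inv_left[OF pos_def_invertible[OF E]])
  define S where "S = transpose H ** (Ei ** H)"
  have tS: "transpose S = S" unfolding S_def by (simp only: matrix_transpose_mul transpose_transpose tEi matrix_mul_assoc)
  \<comment> \<open>The inner \<open>H C^-1 H'\<close> is \<open>E\<close> and cancels one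
    \<open>Ei\<close>. This is the idempotence of \<open>C^-1/2 S C^-1/2\<close> stated without
    roots.\<close>
  have "S ** (Ci ** S) = transpose H ** ((Ei ** E) ** (Ei ** H))"
    unfolding S_def E_def by (simp only: matrix_mul_assoc)
  then have SCS: "S ** (Ci ** S) = S" unfolding Ei_E matrix_mul_lid S_def .
  have tr_CiS: "trace (Ci ** S) = q"
  proof -
    have "trace (Ci ** S) = trace ((Ci ** transpose H) ** (Ei ** H))" unfolding S_def by (simp only: matrix_mul_assoc)
    also have "\<dots> = trace ((Ei ** H) ** (Ci ** transpose H))" by (rule trace_mul_sym)
    also have "(Ei ** H) ** (Ci ** transpose H) = Ei ** E" unfolding E_def by (simp only: matrix_mul_assoc)
    finally show ?thesis by (simp add: Ei_E trace_I q_def)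
  qed

  define G where "G = Ci ** transpose N"
  define B where "B = Ci ** (S ** G)"
  define P where "P = transpose G ** (S ** G)"
  define R where "R = mat 1 - N ** G"
  note proj = gls_projections[OF NN pos_def_invertible[OF C] tS SCS[unfolded Ci_def],
      folded Ci_def, folded G_def, folded B_def P_def R_def]

  \<comment> \<open>Estimators and test statistic as functions of the whitened error\<close>
  have gls_eq: "gls X V (X *v \<beta> + L *v z) = \<beta> + G *v z" for z
  proof -
    have "gls X V (X *v \<beta> + L *v z) = (Ci ** transpose X ** matrix_inv V) *v (X *v \<beta>)
        + (Ci ** transpose X ** matrix_inv V) *v (L *v z)"
      by (simp add: gls_def matrix_vector_right_distrib Ci_def C_def)
    also have "(Ci ** transpose X ** matrix_inv V) *v (X *v \<beta>) = (Ci ** C) *v \<beta>"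
      unfolding C_def gram_def by (simp only: matrix_vector_mul_assoc matrix_mul_assoc)
    also have "Ci ** C = mat 1" unfolding Ci_def by (rule matrix_inv_left[OF pos_def_invertible[OF C]])
    also have "(Ci ** transpose X ** matrix_inv V) *v (L *v z) = (Ci ** (transpose X ** (Li ** (Li ** L)))) *v z"
      unfolding Vi by (simp only: matrix_vector_mul_assoc matrix_mul_assoc)
    also have "Ci ** (transpose X ** (Li ** (Li ** L))) = G"
      unfolding Li_L G_def N_def by (simp only: matrix_transpose_mul tLi matrix_mul_rid matrix_mul_assoc)
    finally show ?thesis by simp
  qed
  have restr_eq: "restricted_est X V H h (X *v \<beta> + L *v z) = \<beta> + (G - B) *v z" for z
  proof -
    \<comment> \<open>\<open>H0\<close> cancels the constant part, so that only a linear function of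
      \<open>z\<close> remains.\<close>
    have "H *v gls X V (X *v \<beta> + L *v z) - h = H *v (G *v z)"
      by (simp add: gls_eq matrix_vector_right_distrib H0)
    then have "restricted_est X V H h (X *v \<beta> + L *v z) = \<beta> + G *v z - (Ci ** transpose H ** Ei) *v (H *v (G *v z))"
      by (simp add: restricted_est_def gls_eq V1 Ci_def C_def)
    also have "(Ci ** transpose H ** Ei) *v (H *v (G *v z)) = B *v z"
      unfolding B_def S_def by (simp only: matrix_vector_mul_assoc matrix_mul_assoc)
    finally show ?thesis by (simp add: matrix_vector_mult_diff_rdistrib)
  qed
  have diff_eq: "gls X V (X *v \<beta> + L *v z) - restricted_est X V H h (X *v \<beta> + L *v z) = B *v z" for z
    by (simp add: gls_eq restr_eq matrix_vector_mult_diff_rdistrib)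
  define nP where "nP z = (P *v z) \<bullet> (P *v z)" for z
  define nR where "nR z = (R *v z) \<bullet> (R *v z)" for z
  have quad: "(L *v v) \<bullet> (matrix_inv V *v (L *v v)) = v \<bullet> v" for v
  proof -
    have "(L *v v) \<bullet> (matrix_inv V *v (L *v v)) = v \<bullet> (L *v (matrix_inv V *v (L *v v)))"
      by (rule symmetric_inner_swap[OF pos_def_transpose[OF L], symmetric])
    also have "L *v (matrix_inv V *v (L *v v)) = ((L ** Li) ** (Li ** L)) *v v"
      unfolding Vi by (simp only: matrix_vector_mul_assoc matrix_mul_assoc)
    finally show ?thesis by (simp add: Li_L L_Li)
  qed
  have scale_eq: "scale_est X V (X *v \<beta> + L *v z) = nR z / m" for z
  proof -
    have LN: "L ** N = X" unfolding N_def by (simp add: matrix_mul_assoc L_Li)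
    have "X *v \<beta> + L *v z - X *v gls X V (X *v \<beta> + L *v z) = L *v z - (L ** N ** G) *v z"
      by (simp add: gls_eq matrix_vector_right_distrib LN matrix_vector_mul_assoc)
    also have "\<dots> = L *v (R *v z)"
      by (simp add: R_def matrix_vector_mult_diff_rdistrib matrix_vector_mult_diff_distrib
          matrix_vector_mul_assoc matrix_mul_assoc)
    finally show ?thesis by (simp add: scale_est_def quad nR_def m)
  qed
  have stat_eq: "test_stat X V H h (X *v \<beta> + L *v z) = nP z / (q * (nR z / m))" for z
  proof -
    have "(H *v (G *v z)) \<bullet> (Ei *v (H *v (G *v z))) = z \<bullet> ((transpose G ** (transpose H ** (Ei ** (H ** G)))) *v z)"
      unfolding inner_matrix_vector_transpose by (simp only: matrix_vector_mul_assoc matrix_mul_assoc)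
    \<comment> \<open>Doubling the projection turns the quadratic form into the squared norm
      \<open>nP z\<close>.\<close>
    also have "transpose G ** (transpose H ** (Ei ** (H ** G))) = P ** P"
      unfolding proj(2) unfolding P_def S_def by (simp only: matrix_mul_assoc)
    also have "z \<bullet> ((P ** P) *v z) = nP z"
      unfolding nP_def matrix_vector_mul_assoc[symmetric] by (rule symmetric_inner_swap[OF proj(1)])
    finally show ?thesis
      by (simp add: test_stat_def gls_eq matrix_vector_right_distrib H0 V1 scale_eq q_def)
  qed
  \<comment> \<open>holds for \<open>nR z = 0\<close> and \<open>nP z = 0\<close> as well, since both sides are then 0\<close>
  have inv_stat: "d * inverse (test_stat X V H h (X *v \<beta> + L *v z)) = c * (nR z / nP z)" for z
    by (simp add: stat_eq inverse_eq_divide c_d[symmetric] mult_ac)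

  \<comment> \<open>Risks as Gaussian integrals\<close>
  have sL: "(\<sigma> *\<^sub>R L) ** (\<sigma> *\<^sub>R L) = \<sigma>\<^sup>2 *\<^sub>R V"
  proof -
    have "(\<sigma> *\<^sub>R L) ** (\<sigma> *\<^sub>R L) = \<sigma> *\<^sub>R (\<sigma> *\<^sub>R (L ** L))"
      by (simp only: matrix_scalar_ac scalar_matrix_assoc)
    then show ?thesis by (simp add: LL power2_eq_square)
  qed

  \<comment> \<open>Covers all three estimators at once: they differ only in the shrinkage factor
    \<open>f\<close>, and its invariance under a common scaling of both norms is what makes the loss
    homogeneous of degree 2.\<close>
  have risk_eq: "finite_risk M W (\<lambda>\<omega>. est (y \<omega>)) \<beta> \<and>
      risk M W (\<lambda>\<omega>. est (y \<omega>)) \<beta> = sigma_eps_sq * ((\<integral>z. ((G - B) *v z) \<bullet> (W *v ((G - B) *v z)) \<partial>std_gauss)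
        + (\<integral>z. (f (nP z) (nR z))\<^sup>2 * ((B *v z) \<bullet> (W *v (B *v z))) \<partial>std_gauss))"
    if est: "\<And>z. est (X *v \<beta> + L *v z) = \<beta> + ((G - B) *v z + f (nP z) (nR z) *\<^sub>R (B *v z))"
      and f: "\<And>a b t. t > 0 \<Longrightarrow> f (t * a) (t * b) = f a b"
      and f_meas [measurable]: "(\<lambda>z. f (nP z) (nR z)) \<in> borel_measurable borel"
      and int: "integrable std_gauss (\<lambda>z. (f (nP z) (nR z))\<^sup>2 * ((B *v z) \<bullet> (W *v (B *v z))))"
    for est :: "real^'n \<Rightarrow> real^'p" and f :: "real \<Rightarrow> real \<Rightarrow> real"
  proof -
    define loss where "loss z = ((G - B) *v z + f (nP z) (nR z) *\<^sub>R (B *v z)) \<bullet>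
      (W *v ((G - B) *v z + f (nP z) (nR z) *\<^sub>R (B *v z)))" for z
    define k where "k e = loss (Li *v e)" for e
    have kL: "k (L *v z) = loss z" for z by (simp add: k_def matrix_vector_mul_assoc Li_L)
    have loss_hom: "loss (t *\<^sub>R z) = t\<^sup>2 * loss z" if "t > 0" for t z
    proof -
      have "nP (t *\<^sub>R z) = t\<^sup>2 * nP z" "nR (t *\<^sub>R z) = t\<^sup>2 * nR z"
        by (simp_all add: nP_def nR_def matrix_vector_mult_scaleR power2_eq_square)
      then have "f (nP (t *\<^sub>R z)) (nR (t *\<^sub>R z)) = f (nP z) (nR z)" using f[of "t\<^sup>2"] that by simp
      then have "(G - B) *v (t *\<^sub>R z) + f (nP (t *\<^sub>R z)) (nR (t *\<^sub>R z)) *\<^sub>R (B *v (t *\<^sub>R z))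
        = t *\<^sub>R ((G - B) *v z + f (nP z) (nR z) *\<^sub>R (B *v z))"
        by (simp add: matrix_vector_mult_scaleR scaleR_add_right mult.commute)
      then show ?thesis
        by (simp only: loss_def matrix_vector_mult_scaleR inner_scaleR_left inner_scaleR_right power2_eq_square mult.assoc)
    qed
    have k_hom: "\<forall>t x. t > 0 \<longrightarrow> k (t *\<^sub>R x) = t\<^sup>2 * k x"
      by (simp add: k_def matrix_vector_mult_scaleR loss_hom)
    have [measurable]: "loss \<in> borel_measurable borel" unfolding loss_def by measurable
    have k_meas: "k \<in> borel_measurable borel" unfolding k_def by measurable
    \<comment> \<open>The reflection negates \<open>P z\<close> and, because \<open>R P = 0\<close>,
      fixes \<open>R z\<close>; both norms are unchanged.\<close>
    have refl: "f (nP (z - 2 *\<^sub>R (P *v z))) (nR (z - 2 *\<^sub>R (P *v z))) = f (nP z) (nR z)" for z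
    proof -
      have "R ** P = 0"
      proof -
        have "transpose (P ** R) = R ** P" by (simp only: matrix_transpose_mul proj(1,3))
        then show ?thesis by (simp add: proj(5) transpose_def zero_vec_def)
      qed
      then have "R *v (z - 2 *\<^sub>R (P *v z)) = R *v z - 2 *\<^sub>R 0"
        by (simp only: matrix_vector_mult_diff_distrib matrix_vector_mult_scaleR matrix_vector_mul_assoc
            matrix_vector_mult_0)
      moreover have "P *v (z - 2 *\<^sub>R (P *v z)) = P *v z - 2 *\<^sub>R (P *v z)"
        by (simp only: matrix_vector_mult_diff_distrib matrix_vector_mult_scaleR matrix_vector_mul_assoc proj(2))
      ultimately show ?thesis by (simp add: nP_def nR_def scaleR_2)
    qed
    note SL = std_gauss_shrinkage_loss[OF proj(1,2) W proj(6,7) f_meas refl int, folded loss_def]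
    have scaled: "k ((\<sigma> *\<^sub>R L) *v z) = \<sigma>\<^sup>2 * loss z" for z
      using k_hom sigma by (simp add: scaleR_matrix_vector_assoc[symmetric] kL)
    have int_k: "integrable std_gauss (\<lambda>z. k ((\<sigma> *\<^sub>R L) *v z))"
      unfolding scaled using SL(1) by (rule integrable_mult_right)
    note ell = elliptical_homogeneous_expectation[OF pos_def_scaleR[OF L sigma] k_meas k_hom int_k mixing, unfolded sL,
        OF \<open>elliptical M eps 0 (\<sigma>\<^sup>2 *\<^sub>R V) g\<close> \<open>normal_mixture Wp Wm (\<sigma>\<^sup>2 *\<^sub>R V) g\<close>]
    have "quad_loss W (est (y \<omega>)) \<beta> = k (eps \<omega>)" if "\<omega> \<in> space M" for \<omega>
    proof -
      have "L *v (Li *v eps \<omega>) = eps \<omega>" by (simp add: matrix_vector_mul_assoc L_Li)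
      then have "est (y \<omega>) - \<beta> = (G - B) *v (Li *v eps \<omega>)
          + f (nP (Li *v eps \<omega>)) (nR (Li *v eps \<omega>)) *\<^sub>R (B *v (Li *v eps \<omega>))"
        using est[of "Li *v eps \<omega>"] y[OF that] by simp
      then show ?thesis by (simp add: quad_loss_def k_def loss_def)
    qed
    then have "finite_risk M W (\<lambda>\<omega>. est (y \<omega>)) \<beta>" "risk M W (\<lambda>\<omega>. est (y \<omega>)) \<beta> = (\<integral>\<omega>. k (eps \<omega>) \<partial>M)"
      using ell(1) unfolding finite_risk_def risk_def
      by (simp_all cong: Bochner_Integration.integrable_cong Bochner_Integration.integral_cong)
    then show ?thesis
      unfolding ell(2) scaled using SL(2) by (simp add: sigma_eps mult_ac)
  qed

  \<comment> \<open>For a signed mixing measure this is not evident from the definition. It follows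
    since \<open>sigma_eps_sq\<close> times the sample size is the expectation of
    \<open>|L^-1 eps|^2\<close>.\<close>
  have sigma_eps_nonneg: "sigma_eps_sq \<ge> 0"
  proof -
    define k where "k e = (Li *v e) \<bullet> (Li *v e)" for e
    have k_sL: "k ((\<sigma> *\<^sub>R L) *v z) = \<sigma>\<^sup>2 * block_norm2 UNIV z" for z
      by (simp add: k_def scaleR_matrix_vector_assoc[symmetric] matrix_vector_mult_scaleR matrix_vector_mul_assoc
          Li_L block_norm2_def inner_vec_def power2_eq_square sum_distrib_left mult_ac)
    have k_meas: "k \<in> borel_measurable borel" unfolding k_def by measurable
    have k_hom: "\<forall>t x. t > 0 \<longrightarrow> k (t *\<^sub>R x) = t\<^sup>2 * k x"
      by (simp add: k_def matrix_vector_mult_scaleR power2_eq_square)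
    have "integrable std_gauss (\<lambda>z. k ((\<sigma> *\<^sub>R L) *v z))"
      unfolding k_sL using std_gauss_block_norm2(1) by (rule integrable_mult_right)
    from elliptical_homogeneous_expectation(2)[OF pos_def_scaleR[OF L sigma] k_meas k_hom this mixing, unfolded sL,
        OF \<open>elliptical M eps 0 (\<sigma>\<^sup>2 *\<^sub>R V) g\<close> \<open>normal_mixture Wp Wm (\<sigma>\<^sup>2 *\<^sub>R V) g\<close>]
    have "(\<integral>\<omega>. k (eps \<omega>) \<partial>M) = sigma_eps_sq * CARD('n)"
      unfolding k_sL by (simp add: std_gauss_block_norm2(2) sigma_eps)
    moreover have "0 \<le> (\<integral>\<omega>. k (eps \<omega>) \<partial>M)" by (simp add: k_def)
    ultimately show ?thesis by (simp add: zero_le_mult_iff)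
  qed

  \<comment> \<open>The trace of the leading block\<close>
  define K where "K = transpose B ** (W ** B)"
  have K: "(B *v z) \<bullet> (W *v (B *v z)) = z \<bullet> (K *v z)" for z
    unfolding inner_matrix_vector_transpose K_def by (simp only: matrix_vector_mul_assoc matrix_mul_assoc)
  have PKP: "P ** K ** P = K"
  proof -
    have "transpose (B ** P) = transpose B" by (simp only: proj)
    then have "P ** transpose B = transpose B" by (simp only: matrix_transpose_mul proj(1))
    moreover have "P ** K ** P = (P ** transpose B) ** (W ** (B ** P))"
      unfolding K_def by (simp only: matrix_mul_assoc)
    ultimately show ?thesis by (simp only: proj(7) K_def)
  qed
  \<comment> \<open>By cyclicity both sides are the trace of \<open>C^-1 S C^-1 W\<close>: the
    rotation \<open>Q\<close> cancels, the inverse roots combine in pairs to \<open>C^-1\<close>,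
    and \<open>B B' = C^-1 S C^-1\<close>.\<close>
  have trK: "trace K = trace (leading_block ix A)"
  proof -
    define D where "D = matrix_inv_sqrt C"
    have DD: "D ** D = Ci" unfolding D_def Ci_def by (rule matrix_inv_sqrt_square[OF C])
    have QQ: "transpose Q ** Q = mat 1" using \<open>orthogonal_matrix Q\<close> by (simp add: orthogonal_matrix_def)
    have bi: "block_identity ix = Q ** (D ** (S ** (D ** transpose Q)))"
      using \<open>Q ** matrix_inv_sqrt (gram X V) ** transpose H ** V1 X V H ** H
           ** matrix_inv_sqrt (gram X V) ** transpose Q = block_identity ix\<close>
      by (simp only: V1 C_def[symmetric] D_def[symmetric] S_def matrix_mul_assoc)
    have A: "A = Q ** (D ** (W ** (D ** transpose Q)))"
      unfolding \<open>A = _\<close> by (simp only: C_def[symmetric] D_def[symmetric] matrix_mul_assoc)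
    have "block_identity ix ** A = Q ** (D ** (S ** (D ** ((transpose Q ** Q) ** (D ** (W ** (D ** transpose Q)))))))"
      unfolding bi A by (simp only: matrix_mul_assoc)
    also have "trace \<dots> = trace ((D ** (S ** (D ** (D ** (W ** (D ** transpose Q)))))) ** Q)"
      unfolding QQ matrix_mul_lid by (rule trace_mul_sym)
    also have "(D ** (S ** (D ** (D ** (W ** (D ** transpose Q)))))) ** Q
        = D ** (S ** ((D ** D) ** (W ** (D ** (transpose Q ** Q)))))"
      by (simp only: matrix_mul_assoc)
    also have "\<dots> = D ** (S ** (Ci ** (W ** D)))" by (simp only: QQ DD matrix_mul_rid)
    also have "trace \<dots> = trace ((S ** (Ci ** (W ** D))) ** D)" by (rule trace_mul_sym)
    also have "(S ** (Ci ** (W ** D))) ** D = (S ** Ci) ** (W ** (D ** D))" by (simp only: matrix_mul_assoc)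
    also have "\<dots> = ((S ** Ci) ** W) ** Ci" by (simp only: DD matrix_mul_assoc)
    also have "trace \<dots> = trace (Ci ** ((S ** Ci) ** W))" by (rule trace_mul_sym)
    also have "Ci ** ((S ** Ci) ** W) = (B ** transpose B) ** W" by (simp only: proj(10) matrix_mul_assoc)
    also have "trace \<dots> = trace (W ** (B ** transpose B))" by (rule trace_mul_sym)
    also have "W ** (B ** transpose B) = (W ** B) ** transpose B" by (simp only: matrix_mul_assoc)
    also have "trace \<dots> = trace K" unfolding K_def by (rule trace_mul_sym)
    finally show ?thesis by (simp only: trace_leading_block[OF \<open>inj ix\<close>])
  qed

  \<comment> \<open>The three risks and their comparison\<close>
  define w where "w z = (1 - c * (nR z / nP z))\<^sup>2" for z
  note Stein = std_gauss_Stein_expectation[OF proj(1-5) proj(8)[unfolded tr_CiS] proj(9)[folded m] q PKP, of c,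
      folded nP_def nR_def, folded w_def]
  have Stein_value: "(\<integral>z. w z * (z \<bullet> (K *v z)) \<partial>std_gauss) = (1 - d) * trace K"
  proof -
    \<comment> \<open>At this \<open>c\<close> the quadratic term is \<open>c m\<close>, half the
      size of the linear term \<open>2 c m\<close>, so the bracket collapses to
      \<open>q - c m\<close>.\<close>
    have "c\<^sup>2 * m * (m + 2) / (q - 2) = c * m"
      using q m_pos by (simp add: c_def power2_eq_square)
    moreover have "c * m = d * q" using c_d m_pos by (simp add: field_simps)
    ultimately have "q - 2 * c * m + c\<^sup>2 * m * (m + 2) / (q - 2) = (1 - d) * q" by (simp add: algebra_simps)
    then show ?thesis using q by (simp add: Stein(2))
  qed
  have [measurable]: "nP \<in> borel_measurable borel" "nR \<in> borel_measurable borel"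
    unfolding nP_def nR_def by measurable
  have K_nonneg: "0 \<le> z \<bullet> (K *v z)" for z
    using pos_def_quadratic_form_nonneg[OF W, of "B *v z"] by (simp add: K)

  let ?risk0 = "\<integral>z. ((G - B) *v z) \<bullet> (W *v ((G - B) *v z)) \<partial>std_gauss"
  have restricted: "finite_risk M W (\<lambda>\<omega>. restricted_est X V H h (y \<omega>)) \<beta>"
    "risk M W (\<lambda>\<omega>. restricted_est X V H h (y \<omega>)) \<beta> = sigma_eps_sq * ?risk0"
    using risk_eq[of "restricted_est X V H h" "\<lambda>_ _. 0"] by (simp_all add: restr_eq)

  have stein_eq: "stein_est d X V H h (X *v \<beta> + L *v z) = \<beta> + ((G - B) *v z + (1 - c * (nR z / nP z)) *\<^sub>R (B *v z))" for z
    unfolding stein_est_def inv_stat diff_eq unfolding gls_eq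
    by (simp add: matrix_vector_mult_diff_rdistrib scaleR_left_diff_distrib)
  have stein: "finite_risk M W (\<lambda>\<omega>. stein_est d X V H h (y \<omega>)) \<beta>"
    "risk M W (\<lambda>\<omega>. stein_est d X V H h (y \<omega>)) \<beta> = sigma_eps_sq * (?risk0 + (1 - d) * trace K)"
    using risk_eq[of "stein_est d X V H h" "\<lambda>a b. 1 - c * (b / a)", OF stein_eq] Stein(1) Stein_value
    by (simp_all add: K w_def)

  \<comment> \<open>The argument of the indicator is the statistic in terms of
    \<open>a = nP z\<close> and \<open>b = nR z\<close>. Both factors involve only ratios of
    \<open>a\<close> and \<open>b\<close>, whence the scale invariance.\<close>
  define f where "f a b = (1 - c * (b / a)) * indicator {d<..} (a / (q * (b / m)))" for a b :: real
  have plus_eq: "pos_stein_est d X V H h (X *v \<beta> + L *v z) = \<beta> + ((G - B) *v z + f (nP z) (nR z) *\<^sub>R (B *v z))" for z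
    unfolding pos_stein_est_def inv_stat diff_eq by (simp add: stat_eq restr_eq f_def)
  have f_meas: "(\<lambda>z. f (nP z) (nR z)) \<in> borel_measurable borel" unfolding f_def by measurable
  have f_int: "integrable std_gauss (\<lambda>z. (f (nP z) (nR z))\<^sup>2 * ((B *v z) \<bullet> (W *v (B *v z))))"
  proof (rule Bochner_Integration.integrable_bound[OF Stein(1)])
    show "(\<lambda>z. (f (nP z) (nR z))\<^sup>2 * ((B *v z) \<bullet> (W *v (B *v z)))) \<in> borel_measurable std_gauss"
      using f_meas by measurable
    \<comment> \<open>An indicator only truncates the Stein factor, so the Stein loss supplies the
      integrable bound.\<close>
    have "(f (nP z) (nR z))\<^sup>2 \<le> w z" for z
      by (simp add: f_def w_def power_mult_distrib indicator_def)
    then show "AE z in std_gauss. norm ((f (nP z) (nR z))\<^sup>2 * ((B *v z) \<bullet> (W *v (B *v z)))) \<le> norm (w z * (z \<bullet> (K *v z)))"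
      by (intro AE_I2) (simp add: K K_nonneg abs_mult mult_right_mono w_def)
  qed
  have f_hom: "f (t * a) (t * b) = f a b" if "t > 0" for a b t
    using that by (simp add: f_def)
  have plus: "finite_risk M W (\<lambda>\<omega>. pos_stein_est d X V H h (y \<omega>)) \<beta>"
    "risk M W (\<lambda>\<omega>. pos_stein_est d X V H h (y \<omega>)) \<beta>
      = sigma_eps_sq * (?risk0 + (\<integral>z. (f (nP z) (nR z))\<^sup>2 * ((B *v z) \<bullet> (W *v (B *v z))) \<partial>std_gauss))"
    using risk_eq[of "pos_stein_est d X V H h" f, OF plus_eq f_hom f_meas f_int] by simp_all

  \<comment> \<open>The product is itself the Gaussian integral of a nonnegative function, so its
    sign requires no separate look at \<open>1 - d\<close> or at the trace.\<close>
  have "0 \<le> (1 - d) * trace K"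
    unfolding Stein_value[symmetric] by (intro Bochner_Integration.integral_nonneg) (simp add: w_def K_nonneg)
  then have gain: "0 \<le> sigma_eps_sq * (1 - d) * trace (leading_block ix A)"
    using sigma_eps_nonneg by (simp add: trK[symmetric] mult.assoc)
  \<comment> \<open>The positive-part risk exceeds the restricted one by \<open>sigma_eps_sq\<close>
    times exactly this integral; its value is left unevaluated, its sign decides.\<close>
  have "0 \<le> (\<integral>z. (f (nP z) (nR z))\<^sup>2 * ((B *v z) \<bullet> (W *v (B *v z))) \<partial>std_gauss)"
    by (intro Bochner_Integration.integral_nonneg) (simp add: K K_nonneg)
  then have "sigma_eps_sq * ?risk0 \<le> risk M W (\<lambda>\<omega>. pos_stein_est d X V H h (y \<omega>)) \<beta>"
    unfolding plus(2) using sigma_eps_nonneg by (intro mult_left_mono) simp_all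
  then show ?thesis
    using restricted stein plus(1) gain by (simp add: trK algebra_simps)
qed

end
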